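(* Let $\{b(n)\}_{n\ge1}$ be a real sequence and let $\{\tilde b_\omega(n)\}_{n\ge1}$ be a sequence of independent real-valued random variables with zero mean on a probability space $(\Omega,\mathcal F,P)$ such that $$\sum_{n=1}^\infty\langle\tilde b_\omega(n)^2\rangle<\infty .$$ Let $\Gamma_0=\Gamma_0(\{b(n)\})$ be the set of all $E\in\mathbb R$ for which the sequence $t^E(n)=\|T^E(n)\|$ of norms of the $n$-step transfer matrices of $J(\mathbf 1,\{b(n)\})$ is bounded in $n$. Then, for $P$-a.e. $\omega$, $$\Sigma_{\rm ac}(\mathbf 1,\{b(n)\})\cap\Gamma_0=\Sigma_{\rm ac}(\mathbf 1,\{b(n)+\tilde b_\omega(n)\})\cap\Gamma_0 .$$
   Context: For real sequences $\{a(n)\}_{n\ge1},\{b(n)\}_{n\ge1}$ with $a(n)>0$, $J(\{a(n)\},\{b(n)\})$ is the semi-infinite tridiagonal (Jacobi) matrix with diagonal entries $b(1),b(2),\dots$ and off-diagonal entries $a(1),a(2),\dots$, viewed as an operator on $\ell^2(\mathbb Z_+)$, $\mathbb Z_+=\{1,2,\dots\}$. $\mathbf 1$ denotes the constant sequence $a(n)=1$ for all $n$; in this case $J(\mathbf 1,\{b(n)\})$ is self-adjoint. Let $\mu$ be the spectral measure of the cyclic vector $\delta_1=(1,0,0,\dots)$ and $\mu_{\rm ac}$ its absolutely continuous part with respect to Lebesgue measure. The essential support of an absolutely continuous measure $\nu$ on $\mathbb R$ is the equivalence class $\Sigma_{\rm ac}(\nu)$ (modulo Lebesgue-null sets) of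 sets $A\subseteq\mathbb R$ such that $\nu$ is supported on $A$ and the restriction of Lebesgue measure to $A$ is absolutely continuous with respect to $\nu$. $\Sigma_{\rm ac}(\{a(n)\},\{b(n)\})$ denotes $\Sigma_{\rm ac}(\mu_{\rm ac})$ for $J(\{a(n)\},\{b(n)\})$. For measurable $B\subseteq\mathbb R$, $\Sigma_{\rm ac}\cap B$ is the equivalence class of the sets $A\cap B$ with $A\in\Sigma_{\rm ac}$. Transfer matrices of $J(\mathbf 1,\{b(n)\})$: for $E\in\mathbb R$ and $n\ge1$, $$S^E(n)=\begin{pmatrix}E-b(n)&-1\\1&0\end{pmatrix},\qquad T^E(n)=S^E(n)S^E(n-1)\cdots S^E(1).$$ For a measurable function $f_\omega$ of $\omega$, $\langle f_\omega\rangle=\int_\Omega f_\omega\,dP(\omega)$. *)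

theory Defs
  imports "HOL-Probability.Probability"
begin

text \<open>
  Sequences indexed by $\{1,2,\dots\}$ are functions on \<^typ>\<open>nat\<close> whose value at \<open>0\<close> is irrelevant
  (coefficients, random variables) or required to be \<open>0\<close> (elements of $\ell^2$).
\<close>

section \<open>Jacobi operators\<close>

definition ell2 :: "(nat \<Rightarrow> complex) set" where
  "ell2 = {u. u 0 = 0 \<and> summable (\<lambda>n. (cmod (u n))\<^sup>2)}"

definition ell2_inner :: "(nat \<Rightarrow> complex) \<Rightarrow> (nat \<Rightarrow> complex) \<Rightarrow> complex" where
  "ell2_inner u v = (\<Sum>n. cnj (u n) * v n)"

definition delta1 :: "nat \<Rightarrow> complex" where
  "delta1 n = (if n = 1 then 1 else 0)"

definition jacobi :: "(nat \<Rightarrow> real) \<Rightarrow> (nat \<Rightarrow> real) \<Rightarrow> (nat \<Rightarrow> complex) \<Rightarrow> nat \<Rightarrow> complex" where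
  "jacobi a b u n =
     (if n = 0 then 0
      else if n = 1 then of_real (b 1) * u 1 + of_real (a 1) * u 2
      else of_real (a (n - 1)) * u (n - 1) + of_real (b n) * u n + of_real (a n) * u (n + 1))"

text \<open>
  The diagonal may be unbounded, so the domain matters. This is the maximal domain; for
  $a \equiv 1$ (limit point case) the operator with this domain is self-adjoint.
\<close>
definition jacobi_domain :: "(nat \<Rightarrow> real) \<Rightarrow> (nat \<Rightarrow> real) \<Rightarrow> (nat \<Rightarrow> complex) set" where
  "jacobi_domain a b = {u \<in> ell2. jacobi a b u \<in> ell2}"

definition jacobi_resolvent ::
    "(nat \<Rightarrow> real) \<Rightarrow> (nat \<Rightarrow> real) \<Rightarrow> complex \<Rightarrow> (nat \<Rightarrow> complex) \<Rightarrow> nat \<Rightarrow> complex" where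
  "jacobi_resolvent a b z v =
     (THE u. u \<in> jacobi_domain a b \<and> (\<forall>n. jacobi a b u n - z * u n = v n))"

text \<open>
  The spectral measure $\mu$ of a self-adjoint operator $J$ and a vector $\psi$ is the finite Borel
  measure whose Borel transform is the diagonal matrix element of the resolvent,
  $\int (x-z)^{-1}\,d\mu(x) = \langle\psi,(J-z)^{-1}\psi\rangle$ for all non-real $z$; here
  $\psi = \delta_1$. Existence and uniqueness are part of the spectral theorem.
\<close>
definition spectral_measure :: "(nat \<Rightarrow> real) \<Rightarrow> (nat \<Rightarrow> real) \<Rightarrow> real measure" where
  "spectral_measure a b =
     (THE \<mu>. sets \<mu> = sets borel \<and> finite_measure \<mu> \<and>
        (\<forall>z. Im z \<noteq> 0 \<longrightarrow>
           (\<integral>x. 1 / (complex_of_real x - z) \<partial>\<mu>)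
             = ell2_inner delta1 (jacobi_resolvent a b z delta1)))"

section \<open>Absolutely continuous part and its essential support\<close>

text \<open>The absolutely continuous summand of the Lebesgue decomposition.\<close>
definition ac_part :: "real measure \<Rightarrow> real measure" where
  "ac_part \<mu> =
     (THE \<nu>. sets \<nu> = sets borel \<and> absolutely_continuous lborel \<nu> \<and>
        (\<exists>\<sigma>. sets \<sigma> = sets borel \<and>
             (\<exists>N \<in> null_sets lborel. emeasure \<sigma> (UNIV - N) = 0) \<and>
             (\<forall>A \<in> sets borel. emeasure \<mu> A = emeasure \<nu> A + emeasure \<sigma> A)))"

text \<open>
  The whole equivalence class of Borel sets, as a set of sets. Note that
  \<^term>\<open>absolutely_continuous M N\<close> says that \<open>N\<close> is absolutely continuous with respect to \<open>M\<close>.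
\<close>
definition essential_support :: "real measure \<Rightarrow> real set set" where
  "essential_support \<nu> =
     {A \<in> sets borel. emeasure \<nu> (UNIV - A) = 0 \<and>
        absolutely_continuous \<nu> (density lborel (indicator A))}"

definition Sigma_ac :: "(nat \<Rightarrow> real) \<Rightarrow> (nat \<Rightarrow> real) \<Rightarrow> real set set" where
  "Sigma_ac a b = essential_support (ac_part (spectral_measure a b))"

definition class_Int :: "real set set \<Rightarrow> real set \<Rightarrow> real set set" where
  "class_Int \<Sigma> B = {A \<inter> B | A. A \<in> \<Sigma>}"

section \<open>Transfer matrices\<close>

definition step_matrix :: "(nat \<Rightarrow> real) \<Rightarrow> real \<Rightarrow> nat \<Rightarrow> real^2^2" where
  "step_matrix b E n = vector [vector [E - b n, -1], vector [1, 0]]"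

primrec transfer_matrix :: "(nat \<Rightarrow> real) \<Rightarrow> real \<Rightarrow> nat \<Rightarrow> real^2^2" where
  "transfer_matrix b E 0 = mat 1"
| "transfer_matrix b E (Suc n) = step_matrix b E (Suc n) ** transfer_matrix b E n"

text \<open>The operator norm; \<^const>\<open>norm\<close> on \<^typ>\<open>real^2^2\<close> would be the Frobenius norm.\<close>
definition transfer_norm :: "(nat \<Rightarrow> real) \<Rightarrow> real \<Rightarrow> nat \<Rightarrow> real" where
  "transfer_norm b E n = onorm (\<lambda>v. transfer_matrix b E n *v v)"

definition Gamma0 :: "(nat \<Rightarrow> real) \<Rightarrow> real set" where
  "Gamma0 b = {E. bounded (transfer_norm b E ` {1..})}"

end

theory Submission
  imports Defs "HOL-Complex_Analysis.Complex_Analysis" "HOL-Real_Asymp.Real_Asymp"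
begin

text \<open>
Write \<open>\<mu>\<close> for the spectral measure of the unperturbed potential or of a perturbed one, and call a Borel
subset of \<open>\<Gamma>\<^sub>0\<close> full if its complement in \<open>\<Gamma>\<^sub>0\<close> is Lebesgue null. Both sides of the claimed identity turn
out to be the family of all full Borel subsets of \<open>\<Gamma>\<^sub>0\<close>. By \<open>class_Int_ac_part\<close> this only needs that
Lebesgue measure on \<open>\<Gamma>\<^sub>0\<close> is absolutely continuous with respect to \<open>\<mu>\<close>: the singular part of \<open>\<mu>\<close> lives
on a null set, so removing that set from a set of positive Lebesgue measure leaves positive mass.

The positivity comes from Carmona's approximation. Let \<open>p\<close> be the solution of the eigenvalue equation at
energy \<open>E\<close> with \<open>p(0) = 0\<close>, \<open>p(1) = 1\<close>. The probability measures
\<open>d\<mu>\<^sub>n = dE / (\<pi> (p(n)\<^sup>2 + p(n+1)\<^sup>2))\<close> converge weakly to \<open>\<mu>\<close> (\<open>carmona_weak_convergence\<close>). For a compact set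
\<open>F\<close> the Cauchy--Schwarz inequality gives \<open>\<mu>\<^sub>n(F) \<ge> |F|\<^sup>2 / (\<pi> L)\<close> as soon as the integral of
\<open>p(n)\<^sup>2 + p(n+1)\<^sup>2\<close> over \<open>F\<close> is at most \<open>L\<close>, and closed sets keep lower bounds under weak limits. So if
the integrals over a bounded set \<open>S\<close> stay below one constant for infinitely many \<open>n\<close>, then \<open>\<mu>\<close> charges every
subset of \<open>S\<close> of positive Lebesgue measure (\<open>spectral_measure_positive\<close>).

For the unperturbed potential the integrand is bounded on each of the countably many pieces of \<open>\<Gamma>\<^sub>0\<close> on which the
transfer matrices have a common bound. For the perturbed potential, expand \<open>p\<close> in solutions of the
unperturbed equation. Every new random value enters the coordinates linearly and is centred and independent of the past, so the
second moment of the coordinates grows at step \<open>n\<close> by a factor \<open>1 + O(\<sigma>\<^sub>n\<^sup>2)\<close> only; as the variances are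
summable it stays bounded (\<open>coord_sq_second_moment\<close>). Tonelli's theorem and Fatou's lemma then bound the
integrals, for almost every \<open>\<omega>\<close>, along a subsequence that depends on \<open>\<omega>\<close>.

The weak convergence is proved through Borel transforms. The transform of \<open>\<mu>\<^sub>n\<close> is the first entry of the
solution of \<open>(J - z) u = \<delta>\<^sub>1\<close> on \<open>{1..n}\<close> with \<open>u(n+1) = -i u(n)\<close>, by Cauchy's formula on large half discs.
Green's identity bounds these solutions in \<open>\<ell>\<^sup>2\<close> uniformly in \<open>n\<close>. This makes \<open>\<mu>\<^sub>n\<close> tight, and it turns every
weak limit into a measure whose transform is the first entry of an \<open>\<ell>\<^sup>2\<close> solution. Such a solution is unique,
and a finite measure is determined by its transform, so the limit exists and is \<open>\<mu>\<close>.
\<close>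

section \<open>Solutions of the three-term recurrence\<close>

text \<open>
The recurrence is read as an equation at the sites \<open>1, 2, \<dots>\<close>; the value at \<open>0\<close> encodes the boundary
condition. The Dirichlet solution starts from \<open>(0, 1)\<close>. A solution of \<open>(J - z) u = \<delta>\<^sub>1\<close> becomes a homogeneous
one after setting its value at \<open>0\<close> to \<open>-1\<close>, since the missing neighbour of site \<open>1\<close> supplies the source.
The scalars are real for transfer matrices and complex for resolvents.
\<close>
fun recur :: "(nat \<Rightarrow> real) \<Rightarrow> 'a::real_normed_field \<Rightarrow> 'a \<Rightarrow> 'a \<Rightarrow> nat \<Rightarrow> 'a" where
  "recur b z x y 0 = x"
| "recur b z x y (Suc 0) = y"
| "recur b z x y (Suc (Suc n)) =
     (z - of_real (b (Suc n))) * recur b z x y (Suc n) - recur b z x y n"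

lemma recur_of_real:
  "recur b (of_real E) (of_real x) (of_real y) n = of_real (recur b E x y n)"
  by (induction b E x y n rule: recur.induct) simp_all

lemma recur_linear:
  "recur b z x y n = x * recur b z 1 0 n + y * recur b z 0 1 n"
  by (induction b z x y n rule: recur.induct) (simp_all add: algebra_simps)

lemma recur_cnj: "recur b (cnj z) (cnj x) (cnj y) n = cnj (recur b z x y n)"
  by (induction b z x y n rule: recur.induct) simp_all

lemma recur_unique:
  assumes "\<And>n. u (Suc (Suc n)) = (z - of_real (b (Suc n))) * u (Suc n) - u n"
  shows "u n = recur b z (u 0) (u (Suc 0)) n"
  by (induction n rule: induct_nat_012) (simp_all add: assms)

lemma wronskian:
  "recur b z 0 1 (Suc n) * recur b z 1 0 n - recur b z 0 1 n * recur b z 1 0 (Suc n) = 1"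
  by (induction n) (simp_all add: algebra_simps)

text \<open>
Multiplying the recurrence at \<open>k\<close> by the conjugate of \<open>u k\<close> and taking imaginary parts leaves a telescoping
sum, because the potential is real.
\<close>
lemma green_identity:
  fixes b :: "nat \<Rightarrow> real" and z x y :: complex
  defines "u \<equiv> recur b z x y"
  shows "Im (cnj (u n) * u (Suc n)) = Im (cnj x * y) + Im z * (\<Sum>k=1..n. (cmod (u k))\<^sup>2)"
proof (induction n)
  case (Suc n)
  have "cnj (u (Suc n)) * u (Suc (Suc n))
      = (z - of_real (b (Suc n))) * of_real ((cmod (u (Suc n)))\<^sup>2) - cnj (cnj (u n) * u (Suc n))"
    unfolding complex_norm_square by (simp add: u_def algebra_simps)
  then have "Im (cnj (u (Suc n)) * u (Suc (Suc n)))
      = Im z * (cmod (u (Suc n)))\<^sup>2 + Im (cnj (u n) * u (Suc n))"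
    by simp
  with Suc show ?case by (simp add: algebra_simps)
qed (simp add: u_def)

section \<open>The truncated Weyl function\<close>

text \<open>
The Weyl function of the problem on \<open>{1..n}\<close> with the absorbing boundary condition \<open>u (n+1) = -\<i> u n\<close>: the
value at \<open>1\<close> of the solution with \<open>u 0 = -1\<close>, obtained by solving the boundary condition for it. Unlike a
real boundary condition, this one keeps the function regular up to the real axis.
\<close>
definition trunc_denom :: "(nat \<Rightarrow> real) \<Rightarrow> nat \<Rightarrow> complex \<Rightarrow> complex" where
  "trunc_denom b n z = recur b z 0 1 (Suc n) + \<i> * recur b z 0 1 n"

definition trunc_m :: "(nat \<Rightarrow> real) \<Rightarrow> nat \<Rightarrow> complex \<Rightarrow> complex" where
  "trunc_m b n z = (recur b z 1 0 (Suc n) + \<i> * recur b z 1 0 n) / trunc_denom b n z"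

text \<open>
If the Dirichlet solution \<open>p\<close> satisfied the absorbing condition, the boundary term in Green's identity
would be \<open>-|p n|\<^sup>2\<close> while the bulk term is nonnegative; so \<open>p\<close> would vanish at two neighbouring sites, against
the constancy of the Wronskian.
\<close>
lemma trunc_denom_nonzero:
  assumes "Im z \<ge> 0"
  shows "trunc_denom b n z \<noteq> 0"
proof
  assume *: "trunc_denom b n z = 0"
  define p where "p = recur b z 0 1"
  have p: "p (Suc n) = - \<i> * p n"
    using * by (simp add: trunc_denom_def p_def eq_neg_iff_add_eq_0)
  have "0 \<le> Im (cnj (p n) * p (Suc n))"
    using green_identity[of b z 0 1 n] assms by (simp add: p_def sum_nonneg)
  also have "cnj (p n) * p (Suc n) = - \<i> * of_real ((cmod (p n))\<^sup>2)"
    unfolding p complex_norm_square by (simp add: algebra_simps)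
  finally have "p n = 0" by simp
  with p have "p (Suc n) = 0" by simp
  with \<open>p n = 0\<close> show False using wronskian[of b z n] by (simp add: p_def)
qed

lemma trunc_boundary:
  fixes b :: "nat \<Rightarrow> real" and z :: complex and n :: nat
  assumes "Im z \<ge> 0"
  defines "u \<equiv> recur b z (-1) (trunc_m b n z)"
  shows "u (Suc n) = - \<i> * u n"
proof -
  have "u (Suc n) + \<i> * u n = trunc_m b n z * trunc_denom b n z
      - (recur b z 1 0 (Suc n) + \<i> * recur b z 1 0 n)"
    unfolding u_def by (subst (1 2) recur_linear) (simp add: trunc_denom_def algebra_simps)
  also have "\<dots> = 0"
    using trunc_denom_nonzero[OF assms(1)] by (simp add: trunc_m_def)
  finally show ?thesis by (simp add: eq_neg_iff_add_eq_0)
qed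

lemma trunc_energy:
  fixes b :: "nat \<Rightarrow> real" and z :: complex and n :: nat
  assumes "Im z \<ge> 0"
  defines "u \<equiv> recur b z (-1) (trunc_m b n z)"
  shows "Im (trunc_m b n z) = (cmod (u n))\<^sup>2 + Im z * (\<Sum>k=1..n. (cmod (u k))\<^sup>2)"
proof -
  have "cnj (u n) * u (Suc n) = - \<i> * of_real ((cmod (u n))\<^sup>2)"
    using trunc_boundary[OF assms(1), of b n] unfolding u_def complex_norm_square
    by (simp add: algebra_simps)
  then have "Im (cnj (u n) * u (Suc n)) = - (cmod (u n))\<^sup>2" by simp
  then show ?thesis
    using green_identity[where b=b and z=z and x="-1" and y="trunc_m b n z" and n=n] by (simp add: u_def)
qed

lemma Im_trunc_m_real:
  "Im (trunc_m b n (of_real E)) = 1 / ((recur b E 0 1 n)\<^sup>2 + (recur b E 0 1 (Suc n))\<^sup>2)"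
proof -
  have [simp]: "recur b (complex_of_real E) 0 1 k = of_real (recur b E 0 1 k)"
    "recur b (complex_of_real E) 1 0 k = of_real (recur b E 1 0 k)" for k
    using recur_of_real[of b E 0 1 k] recur_of_real[of b E 1 0 k] by simp_all
  show ?thesis
    using wronskian[of b E n]
    by (simp add: trunc_m_def trunc_denom_def Im_divide algebra_simps power2_eq_square)
qed

text \<open>
With \<open>m\<close> the truncated Weyl function, Green's identity says that \<open>Im z\<close> times the energy of \<open>u\<close> is at most
\<open>Im m \<le> |m|\<close>, while the energy is at least \<open>|u 1|\<^sup>2 = |m|\<^sup>2\<close>. The bounds do not depend on \<open>n\<close>.
\<close>
lemma trunc_energy_bounds:
  fixes b :: "nat \<Rightarrow> real" and z :: complex and n :: nat
  assumes z: "Im z > 0" and n: "n \<ge> 1"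
  defines "u \<equiv> recur b z (-1) (trunc_m b n z)"
  shows "cmod (trunc_m b n z) \<le> 1 / Im z"
    and "(\<Sum>k=1..n. (cmod (u k))\<^sup>2) \<le> 1 / (Im z)\<^sup>2"
    and "cmod (u 2) \<le> 1 / Im z"
proof -
  let ?S = "\<Sum>k=1..n. (cmod (u k))\<^sup>2"
  have e: "Im z * ?S \<le> cmod (trunc_m b n z)"
    using trunc_energy[of z b n] z abs_Im_le_cmod[of "trunc_m b n z"] unfolding u_def
    by (smt (verit) zero_le_power2)
  have u1: "u 1 = trunc_m b n z" by (simp add: u_def)
  have "(cmod (u 1))\<^sup>2 \<le> ?S" using n by (intro member_le_sum) auto
  then have "Im z * (cmod (trunc_m b n z))\<^sup>2 \<le> cmod (trunc_m b n z)"
    using e z u1 by (smt (verit) mult_left_mono)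
  then show m: "cmod (trunc_m b n z) \<le> 1 / Im z"
    using z by (cases "trunc_m b n z = 0") (auto simp: field_simps power2_eq_square)
  have "Im z * ?S \<le> 1 / Im z" using e m by linarith
  then show S: "?S \<le> 1 / (Im z)\<^sup>2" using z by (simp add: field_simps power2_eq_square)
  show "cmod (u 2) \<le> 1 / Im z"
  proof (cases "n = 1")
    case True
    then show ?thesis using trunc_boundary[of z b n] z m u1
      by (simp add: u_def numeral_2_eq_2 norm_mult)
  next
    case False
    have "(cmod (u 2))\<^sup>2 \<le> ?S" using n False by (intro member_le_sum) auto
    then have "(cmod (u 2))\<^sup>2 \<le> (1 / Im z)\<^sup>2" using S by (simp add: power_divide)
    then show ?thesis using z by (simp add: abs_le_square_iff[symmetric])
  qed
qed

text \<open>
The recurrence at site \<open>1\<close> expresses \<open>z m + 1\<close> through the bounded quantities \<open>u 2\<close> and \<open>b 1 * m\<close>. The bound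
is uniform in \<open>n\<close>, which is what tightness of the approximating measures needs.
\<close>
lemma trunc_m_asymptotic:
  assumes z: "Im z > 0" and n: "n \<ge> 1"
  shows "cmod (z * trunc_m b n z + 1) \<le> (\<bar>b 1\<bar> + 1) / Im z"
proof -
  define u where "u = recur b z (-1) (trunc_m b n z)"
  have "u 2 = (z - of_real (b 1)) * trunc_m b n z + 1"
    by (simp add: u_def numeral_2_eq_2)
  then have "cmod (z * trunc_m b n z + 1) = cmod (u 2 + of_real (b 1) * trunc_m b n z)"
    by (simp add: algebra_simps)
  also have "\<dots> \<le> cmod (u 2) + \<bar>b 1\<bar> * cmod (trunc_m b n z)"
    by (metis norm_mult norm_of_real norm_triangle_ineq)
  also have "\<dots> \<le> 1 / Im z + \<bar>b 1\<bar> * (1 / Im z)"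
    using trunc_energy_bounds[OF assms, of b] by (intro add_mono mult_left_mono) (auto simp: u_def)
  finally show ?thesis by (simp add: add_divide_distrib)
qed

text \<open>
For \<open>z\<close> large compared with the potential on \<open>{1..n}\<close> the recurrence, run from \<open>n\<close> down to \<open>1\<close>, makes \<open>|u|\<close>
nonincreasing in the site: the absorbing condition starts the induction with \<open>|u (n+1)| = |u n|\<close>. Here \<open>z\<close> may be
real, and the threshold depends on \<open>n\<close>.
\<close>
lemma trunc_decay:
  fixes b :: "nat \<Rightarrow> real" and z :: complex and n :: nat
  assumes z: "Im z \<ge> 0" "cmod z \<ge> B + 2" and n: "n \<ge> 1"
    and B: "\<And>k. 1 \<le> k \<Longrightarrow> k \<le> n \<Longrightarrow> \<bar>b k\<bar> \<le> B"
  defines "u \<equiv> recur b z (-1) (trunc_m b n z)"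
  shows "cmod (trunc_m b n z) \<le> 1 / (cmod z - B - 1)" and "cmod (u n) \<le> cmod (trunc_m b n z)"
proof -
  have zb: "cmod (z - of_real (b k)) \<ge> cmod z - B" if "1 \<le> k" "k \<le> n" for k
    using B[OF that] norm_triangle_ineq2[of z "of_real (b k)"] by simp
  have step: "cmod (u k) \<ge> (cmod z - B) * cmod (u (Suc k)) - cmod (u (Suc (Suc k)))" if "Suc k \<le> n" for k
  proof -
    have "u k = (z - of_real (b (Suc k))) * u (Suc k) - u (Suc (Suc k))" by (simp add: u_def)
    then have "cmod (u k) \<ge> cmod (z - of_real (b (Suc k))) * cmod (u (Suc k)) - cmod (u (Suc (Suc k)))"
      by (metis norm_mult norm_triangle_ineq2)
    moreover have "(cmod z - B) * cmod (u (Suc k)) \<le> cmod (z - of_real (b (Suc k))) * cmod (u (Suc k))"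
      using zb[of "Suc k"] that by (intro mult_right_mono) auto
    ultimately show ?thesis by linarith
  qed
  have dec: "cmod (u (Suc k)) \<le> cmod (u k)" if "k \<le> n" for k
    using that
  proof (induction rule: inc_induct)
    case base
    show ?case using trunc_boundary[OF z(1), of b n] by (simp add: u_def norm_mult)
  next
    case (step k)
    have "2 * cmod (u (Suc k)) \<le> (cmod z - B) * cmod (u (Suc k))"
      using z(2) by (intro mult_right_mono) auto
    then show ?case using step \<open>\<And>k. Suc k \<le> n \<Longrightarrow> _\<close>[of k] by simp
  qed
  have u1: "u (Suc 0) = trunc_m b n z" by (simp add: u_def)
  have "1 \<ge> (cmod z - B) * cmod (trunc_m b n z) - cmod (u 2)"
    using step[of 0] n u1 by (simp add: u_def numeral_2_eq_2)
  moreover have "cmod (u 2) \<le> cmod (trunc_m b n z)"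
    using dec[of 1] n u1 by (simp add: numeral_2_eq_2)
  ultimately have "(cmod z - B - 1) * cmod (trunc_m b n z) \<le> 1" by (simp add: algebra_simps)
  then show "cmod (trunc_m b n z) \<le> 1 / (cmod z - B - 1)"
    using z(2) by (simp add: pos_le_divide_eq mult.commute)
  have "cmod (u n) \<le> cmod (u (Suc 0))"
    using n
  proof (induction rule: dec_induct)
    case (step k) then show ?case using dec[of k] by simp
  qed simp
  then show "cmod (u n) \<le> cmod (trunc_m b n z)" by (simp add: u1)
qed

lemma recur_holomorphic: "(\<lambda>z. recur b z x y n) holomorphic_on A"
  by (induction n rule: induct_nat_012) (auto intro!: holomorphic_intros)

lemma trunc_m_holomorphic: "trunc_m b n holomorphic_on {z. Im z \<ge> 0}"
proof -
  have "trunc_denom b n holomorphic_on {z. Im z \<ge> 0}"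
    unfolding trunc_denom_def by (intro holomorphic_intros recur_holomorphic)
  then show ?thesis
    unfolding trunc_m_def using trunc_denom_nonzero
    by (intro holomorphic_intros recur_holomorphic) auto
qed

section \<open>Cauchy's formula on the upper half plane\<close>

text \<open>
The full circle has integral \<open>2 \<pi> \<i>\<close>. Split it into the two half discs, whose diameters cancel; the lower
half disc does not enclose \<open>z\<close> and contributes nothing.
\<close>
lemma upper_semicircle_winding:
  assumes z: "0 < Im z" "cmod z < R"
  shows "((\<lambda>w. 1 / (w - z)) has_contour_integral 2 * pi * \<i>)
           (linepath (- of_real R) (of_real R) +++ part_circlepath 0 R 0 pi)"
proof -
  let ?f = "\<lambda>w. 1 / (w - z)"
  have R: "R > 0" using z by (metis norm_ge_zero order.strict_trans1)
  have zo: "cmod z \<noteq> R" "Im z \<noteq> 0" using z by auto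
  have real_ne: "w \<noteq> z" if "w \<in> closed_segment (- of_real R) (of_real R)" for w
  proof -
    have "Im w = 0" using that by (auto simp: closed_segment_def)
    then show ?thesis using zo by auto
  qed
  have circ_ne: "w \<noteq> z" if "w \<in> path_image (part_circlepath 0 R s t)" "s \<le> t" for w s t
    using in_path_image_part_circlepath[OF that(1)] that R zo by (auto)
  have int_line: "?f contour_integrable_on linepath (- of_real R) (of_real R)"
    using real_ne by (intro contour_integrable_continuous_linepath continuous_intros) auto
  have int_arc: "?f contour_integrable_on part_circlepath 0 R s t" if "s \<le> t" for s t
    using circ_ne that by (intro contour_integrable_continuous_part_circlepath continuous_intros) auto
  define L where "L = contour_integral (linepath (- of_real R) (of_real R)) ?f"
  define U where "U = contour_integral (part_circlepath 0 R 0 pi) ?f"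
  define D where "D = contour_integral (part_circlepath 0 R pi (2*pi)) ?f"
  have hL: "(?f has_contour_integral L) (linepath (- of_real R) (of_real R))"
    unfolding L_def by (rule has_contour_integral_integral[OF int_line])
  have hU: "(?f has_contour_integral U) (part_circlepath 0 R 0 pi)"
    unfolding U_def by (rule has_contour_integral_integral[OF int_arc]) simp
  have hD: "(?f has_contour_integral D) (part_circlepath 0 R pi (2*pi))"
    unfolding D_def by (rule has_contour_integral_integral[OF int_arc]) simp
  have "(?f has_contour_integral (U + D)) (circlepath 0 R)"
    unfolding circlepath_def using hU hD
    by (subst (asm) (1 2) has_contour_integral_part_circlepath_iff, simp_all,
        subst has_contour_integral_part_circlepath_iff, simp)
       (rule has_integral_combine[of 0 pi], auto)
  moreover have "(?f has_contour_integral (2 * pi * \<i> * 1)) (circlepath 0 R)"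
    using Cauchy_integral_circlepath_simple[of "\<lambda>_. 1" 0 R z] z by (simp add: dist_norm)
  ultimately have UD: "U + D = 2 * pi * \<i>"
    by (metis has_contour_integral_unique mult.right_neutral)
  let ?g = "part_circlepath 0 R pi (2*pi) +++ linepath (of_real R) (- of_real R)"
  let ?S = "{w. Im w \<le> 0}"
  have "(?f has_contour_integral 0) ?g"
  proof (rule Cauchy_theorem_convex_simple[where S = ?S])
    show "?f holomorphic_on ?S" using z by (auto intro!: holomorphic_intros)
    show "convex ?S" by (rule convex_halfspace_Im_le)
    show "valid_path ?g" by (auto intro!: valid_path_join simp: exp_eq_polar)
    show "path_image ?g \<subseteq> ?S"
    proof -
      have "pi \<le> 2*pi" by simp
      have "Im w \<le> 0" if w: "w \<in> path_image (part_circlepath 0 R pi (2*pi))" for w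
      proof -
        obtain x where "pi \<le> x" "x \<le> 2*pi" "w = R * exp (\<i> * x)"
          using w unfolding path_image_part_circlepath[OF \<open>pi \<le> 2*pi\<close>] by auto
        moreover have "sin x \<le> 0" using calculation sin_le_zero by (cases "x = 2*pi") auto
        ultimately show ?thesis using R by (simp add: exp_eq_polar mult_nonneg_nonpos)
      qed
      then show ?thesis by (auto simp: path_image_join exp_eq_polar closed_segment_def)
    qed
    show "pathfinish ?g = pathstart ?g" by (simp add: exp_eq_polar)
  qed
  moreover have "(?f has_contour_integral (D - L)) ?g"
    using has_contour_integral_join[OF hD has_contour_integral_reversepath[OF _ hL]]
    by (simp)
  ultimately have "D = L" using has_contour_integral_unique by fastforce
  have "(?f has_contour_integral (L + U)) (linepath (- of_real R) (of_real R) +++ part_circlepath 0 R 0 pi)"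
    by (rule has_contour_integral_join[OF hL hU]) auto
  then show ?thesis using UD \<open>D = L\<close> by (simp add: add.commute)
qed

lemma upper_semicircle_geometry:
  fixes R :: real
  assumes "R > 0"
  defines "g \<equiv> linepath (- complex_of_real R) (of_real R) +++ part_circlepath 0 R 0 pi"
  shows "valid_path g" "pathfinish g = pathstart g" "path_image g \<subseteq> {w. Im w \<ge> 0}"
    "\<And>w. w \<in> path_image (part_circlepath 0 R 0 pi) \<Longrightarrow> cmod w = R \<and> Im w \<ge> 0"
    "\<And>w. w \<in> path_image g \<Longrightarrow> Im w = 0 \<or> cmod w = R"
proof -
  have arc: "cmod w = R \<and> Im w \<ge> 0" if w: "w \<in> path_image (part_circlepath 0 R 0 pi)" for w
  proof -
    obtain x where "0 \<le> x" "x \<le> pi" "w = R * exp (\<i> * x)"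
      using w by (auto simp: path_image_part_circlepath)
    then show ?thesis using assms(1) by (simp add: exp_eq_polar sin_ge_zero norm_mult)
  qed
  then show "\<And>w. w \<in> path_image (part_circlepath 0 R 0 pi) \<Longrightarrow> cmod w = R \<and> Im w \<ge> 0" by blast
  show "valid_path g" "pathfinish g = pathstart g"
    by (auto simp: g_def exp_eq_polar intro!: valid_path_join)
  show "path_image g \<subseteq> {w. Im w \<ge> 0}" "\<And>w. w \<in> path_image g \<Longrightarrow> Im w = 0 \<or> cmod w = R"
    using arc by (auto simp: g_def path_image_join exp_eq_polar closed_segment_def)
qed

text \<open>
The closed contour is a diameter followed by the upper semicircle; the error term is the estimate of the
integral over the semicircle. The case of \<open>z\<close> in the lower half plane is needed for the conjugate of the
boundary values.
\<close>
lemma half_plane_cauchy_finite: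
  assumes f: "f holomorphic_on {w. Im w \<ge> 0}" and R: "R > cmod z" "Im z \<noteq> 0"
    and bd: "\<And>w. cmod w = R \<Longrightarrow> Im w \<ge> 0 \<Longrightarrow> cmod (f w) \<le> C"
  shows "cmod (integral {-R..R} (\<lambda>x. f (of_real x) / (of_real x - z))
           - (if Im z > 0 then 2 * pi * \<i> * f z else 0)) \<le> C / (R - cmod z) * R * pi"
proof -
  let ?f = "\<lambda>w. f w / (w - z)"
  let ?H = "{w. Im w \<ge> 0}"
  let ?l = "linepath (- complex_of_real R) (of_real R)" and ?c = "part_circlepath 0 R 0 pi"
  have Rp: "R > 0" using R by (metis norm_ge_zero order.strict_trans1)
  note geo = upper_semicircle_geometry[OF Rp]
  have ne: "w \<noteq> z" if "w \<in> path_image (?l +++ ?c)" for w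
    using geo(5)[OF that] R by auto
  have pf: "pathfinish ?l = pathstart ?c" by simp
  have cont: "continuous_on (path_image (?l +++ ?c)) ?f"
    using ne geo(3) holomorphic_on_imp_continuous_on[OF f]
    by (intro continuous_intros) (auto intro: continuous_on_subset)
  have il: "?f contour_integrable_on ?l" and ic: "?f contour_integrable_on ?c"
    by (intro contour_integrable_continuous_linepath contour_integrable_continuous_part_circlepath
          continuous_on_subset[OF cont]; auto simp: path_image_join[OF pf])+
  let ?v = "if Im z > 0 then 2 * pi * \<i> * f z else 0"
  have total: "(?f has_contour_integral ?v) (?l +++ ?c)"
  proof (cases "Im z > 0")
    case True
    have int: "z \<in> interior ?H"
      using True interior_maximal[of "{w. Im w > 0}" ?H] open_halfspace_Im_gt[of 0] by force
    have *: "((\<lambda>w. h w / (w - z)) has_contour_integral (2*pi * \<i> * winding_number (?l +++ ?c) z * h z)) (?l +++ ?c)"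
      if "h holomorphic_on ?H" for h
      using that int geo(1-3) ne
      by (intro Cauchy_integral_formula_convex_simple[where S = ?H]) (auto simp: convex_halfspace_Im_ge)
    have "2*pi * \<i> * winding_number (?l +++ ?c) z = 2 * pi * \<i>"
      using *[of "\<lambda>_. 1"] upper_semicircle_winding[OF True R(1)]
      by (metis has_contour_integral_unique holomorphic_on_const mult.right_neutral)
    with *[OF f] True show ?thesis by simp
  next
    case False
    have "(?f has_contour_integral 0) (?l +++ ?c)"
      using False R geo(1-3)
      by (intro Cauchy_theorem_convex_simple[where S = ?H])
         (auto intro!: holomorphic_intros f simp: convex_halfspace_Im_ge)
    with False show ?thesis by simp
  qed
  have "?v = contour_integral ?l ?f + contour_integral ?c ?f"
    using contour_integral_unique[OF total] contour_integral_join[OF il ic] pf by simp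
  moreover have "contour_integral ?l ?f = integral {-R..R} (\<lambda>x. ?f (of_real x))"
    using Rp by (subst contour_integral_linepath_Reals_eq) auto
  ultimately have "cmod (integral {-R..R} (\<lambda>x. ?f (of_real x)) - ?v) = cmod (contour_integral ?c ?f)"
    by (simp add: norm_minus_commute)
  also have "\<dots> \<le> C / (R - cmod z) * R * (pi - 0)"
  proof (rule has_contour_integral_bound_part_circlepath[OF has_contour_integral_integral[OF ic]])
    have "cmod (f (of_real R * \<i>)) \<le> C" using Rp by (intro bd) (auto simp: norm_mult)
    then have C: "C \<ge> 0" by (meson norm_ge_zero order_trans)
    then show "0 \<le> C / (R - cmod z)" using R by simp
    fix w assume "w \<in> path_image ?c"
    then have w: "cmod w = R" "Im w \<ge> 0" using geo(4) by auto
    have "cmod (w - z) \<ge> R - cmod z" using norm_triangle_ineq2[of w z] w by simp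
    then show "cmod (f w / (w - z)) \<le> C / (R - cmod z)"
      unfolding norm_divide using bd[OF w] C R by (intro frac_le) auto
  qed (use Rp in auto)
  finally show ?thesis by simp
qed

lemma half_plane_cauchy:
  assumes f: "f holomorphic_on {w. Im w \<ge> 0}" and z: "Im z \<noteq> 0"
    and bd: "\<And>w. cmod w \<ge> B + 2 \<Longrightarrow> Im w \<ge> 0 \<Longrightarrow> cmod (f w) \<le> 1 / (cmod w - B - 1)"
  shows "(\<lambda>n. integral {- real n..real n} (\<lambda>x. f (of_real x) / (of_real x - z)))
           \<longlonglongrightarrow> (if Im z > 0 then 2 * pi * \<i> * f z else 0)"
proof (rule LIM_zero_cancel, rule Lim_null_comparison)
  have ev: "eventually (\<lambda>n. real n > c) sequentially" for c :: real
    using filterlim_real_sequentially by (simp add: filterlim_at_top_dense)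
  show "eventually (\<lambda>n. cmod (integral {- real n..real n} (\<lambda>x. f (of_real x) / (of_real x - z)) -
      (if Im z > 0 then 2 * pi * \<i> * f z else 0))
      \<le> 1 / (real n - B - 1) / (real n - cmod z) * real n * pi) sequentially"
    using ev[of "cmod z"] ev[of "B + 2"]
  proof eventually_elim
    case (elim n)
    have "cmod (f w) \<le> 1 / (real n - B - 1)" if "cmod w = real n" "Im w \<ge> 0" for w
      using bd[of w] that elim by simp
    with elim show ?case by (intro half_plane_cauchy_finite f z)
  qed
  show "(\<lambda>n. 1 / (real n - B - 1) / (real n - cmod z) * real n * pi) \<longlonglongrightarrow> 0"
    by real_asymp
qed

section \<open>Borel transforms determine finite measures\<close>

lemma cmod_of_real_diff_ge: "\<bar>Im z\<bar> \<le> cmod (of_real x - z)"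
  using abs_Im_le_cmod[of "of_real x - z"] by simp

lemma of_real_diff_nonzero: "Im z \<noteq> 0 \<Longrightarrow> of_real x - z \<noteq> 0"
  by (auto simp: complex_eq_iff)

lemma resolvent_kernel_bound:
  assumes "Im z \<noteq> 0" shows "cmod (1 / (of_real x - z)) \<le> 1 / \<bar>Im z\<bar>"
  using cmod_of_real_diff_ge[of z x] assms by (simp add: norm_divide frac_le)

lemma isCont_resolvent_kernel:
  assumes "Im z \<noteq> 0" shows "isCont (\<lambda>x. 1 / (of_real x - z)) x"
  by (intro continuous_intros of_real_diff_nonzero assms)

lemma resolvent_kernel_measurable [measurable]:
  "(\<lambda>x. 1 / (complex_of_real x - z)) \<in> borel_measurable borel"
  by measurable

lemma Im_resolvent_kernel:
  "Im (1 / (complex_of_real x - Complex a e)) = e / ((x - a)\<^sup>2 + e\<^sup>2)"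
  by (simp add: Im_divide power2_commute)

definition borel_transform :: "real measure \<Rightarrow> complex \<Rightarrow> complex" where
  "borel_transform \<mu> z = (\<integral>x. 1 / (of_real x - z) \<partial>\<mu>)"

lemma (in finite_borel_measure) integrable_resolvent_kernel:
  assumes "Im z \<noteq> 0"
  shows "integrable M (\<lambda>x. 1 / (complex_of_real x - z))"
proof -
  note M_is_borel[measurable_cong]
  show ?thesis
    using resolvent_kernel_bound[OF assms]
    by (intro integrable_const_bound[where B="1 / \<bar>Im z\<bar>"] AE_I2) auto
qed

lemma (in finite_borel_measure) Im_borel_transform:
  assumes "e \<noteq> 0"
  shows "Im (borel_transform M (Complex a e)) = (\<integral>x. e / ((x - a)\<^sup>2 + e\<^sup>2) \<partial>M)"
    and "integrable M (\<lambda>x. e / ((x - a)\<^sup>2 + e\<^sup>2))"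
  using integrable_resolvent_kernel[of "Complex a e"] assms
  by (auto simp: borel_transform_def Im_resolvent_kernel simp flip: integral_Im dest!: integrable_Im)

lemma borel_transform_cnj: "borel_transform \<mu> (cnj z) = cnj (borel_transform \<mu> z)"
  unfolding borel_transform_def by (subst Bochner_Integration.integral_cnj[symmetric]) simp

text \<open>
The functions \<open>\<epsilon>\<^sup>2 / ((x - a)\<^sup>2 + \<epsilon>\<^sup>2)\<close> are bounded by \<open>1\<close> and tend to the indicator of \<open>{a}\<close>.
\<close>
lemma (in finite_borel_measure) point_mass_limit:
  shows "(\<lambda>k. inverse (real (Suc k)) * Im (borel_transform M (Complex a (inverse (real (Suc k))))))
           \<longlonglongrightarrow> measure M {a}"
proof -
  note M_is_borel[measurable_cong]
  let ?e = "\<lambda>k. inverse (real (Suc k))"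
  have "(\<lambda>k. \<integral>x. (?e k)\<^sup>2 / ((x - a)\<^sup>2 + (?e k)\<^sup>2) \<partial>M) \<longlonglongrightarrow> (\<integral>x. indicator {a} x \<partial>M)"
  proof (rule integral_dominated_convergence[where w="\<lambda>_. 1"])
    show "AE x in M. (\<lambda>k. (?e k)\<^sup>2 / ((x - a)\<^sup>2 + (?e k)\<^sup>2)) \<longlonglongrightarrow> indicator {a} x"
    proof (rule AE_I2)
      fix x
      show "(\<lambda>k. (?e k)\<^sup>2 / ((x - a)\<^sup>2 + (?e k)\<^sup>2)) \<longlonglongrightarrow> indicator {a} x"
      proof (cases "x = a")
        case False
        have "(\<lambda>k. (?e k)\<^sup>2 / ((x - a)\<^sup>2 + (?e k)\<^sup>2)) \<longlonglongrightarrow> 0\<^sup>2 / ((x - a)\<^sup>2 + 0\<^sup>2)"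
          using False by (intro tendsto_intros LIMSEQ_inverse_real_of_nat) auto
        with False show ?thesis by simp
      qed simp
    qed
    show "AE x in M. norm ((?e k)\<^sup>2 / ((x - a)\<^sup>2 + (?e k)\<^sup>2)) \<le> 1" for k
      by (intro AE_I2) (simp add: divide_simps)
  qed auto
  moreover have "?e k * Im (borel_transform M (Complex a (?e k)))
      = (\<integral>x. (?e k)\<^sup>2 / ((x - a)\<^sup>2 + (?e k)\<^sup>2) \<partial>M)" for k
    by (subst Im_borel_transform, simp, subst integral_mult_right_zero[symmetric])
       (simp add: power2_eq_square)
  ultimately show ?thesis by simp
qed

lemma integral_cauchy_kernel:
  assumes "e > 0" "a \<le> b"
  shows "((\<lambda>x. e / ((t - x)\<^sup>2 + e\<^sup>2)) has_integral arctan ((b - t) / e) - arctan ((a - t) / e)) {a..b}"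
proof (rule fundamental_theorem_of_calculus[OF assms(2)])
  fix x assume "x \<in> {a..b}"
  have "1 + ((x - t) / e)\<^sup>2 = ((t - x)\<^sup>2 + e\<^sup>2) / e\<^sup>2"
    using assms by (simp add: field_simps power2_commute)
  moreover have "((\<lambda>x. arctan ((x - t) / e)) has_real_derivative
      inverse (1 + ((x - t) / e)\<^sup>2) * (1 / e)) (at x within {a..b})"
    using assms by (auto intro!: derivative_eq_intros)
  ultimately show "((\<lambda>x. arctan ((x - t) / e)) has_vector_derivative e / ((t - x)\<^sup>2 + e\<^sup>2)) (at x within {a..b})"
    using assms unfolding has_real_derivative_iff_has_vector_derivative[symmetric]
    by (simp add: power2_eq_square)
qed

lemma (in finite_borel_measure) integral_Im_borel_transform:
  assumes e: "e > 0" and ab: "a \<le> b"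
  shows "(LINT x:{a..b}|lborel. Im (borel_transform M (Complex x e)))
      = (\<integral>t. arctan ((b - t) / e) - arctan ((a - t) / e) \<partial>M)"
proof -
  note M_is_borel[measurable_cong]
  interpret P: pair_sigma_finite M lborel ..
  let ?k = "\<lambda>t x. indicator {a..b} x *\<^sub>R (e / ((t - x)\<^sup>2 + e\<^sup>2))"
  have int: "integrable (M \<Otimes>\<^sub>M lborel) (\<lambda>(t, x). ?k t x)"
  proof (rule integrableI_bounded_set[where A="space M \<times> {a..b}" and B="1/e"])
    show "emeasure (M \<Otimes>\<^sub>M lborel) (space M \<times> {a..b}) < \<infinity>"
      by (subst lborel.emeasure_pair_measure_Times)
         (use ab in \<open>auto simp: emeasure_eq_measure ennreal_mult_less_top\<close>)
    show "AE x in M \<Otimes>\<^sub>M lborel. x \<in> space M \<times> {a..b} \<longrightarrow>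
       norm (case x of (t, x) \<Rightarrow> ?k t x) \<le> 1 / e"
    proof (rule AE_I2, clarify)
      fix t x
      have "e / ((t - x)\<^sup>2 + e\<^sup>2) \<le> e / e\<^sup>2"
        using e by (intro divide_left_mono) (auto intro!: mult_pos_pos add_nonneg_pos)
      then show "norm (?k t x) \<le> 1 / e"
        using e by (auto simp: power2_eq_square split: split_indicator)
    qed
    show "AE x in M \<Otimes>\<^sub>M lborel. x \<notin> space M \<times> {a..b} \<longrightarrow> (case x of (t, x) \<Rightarrow> ?k t x) = 0"
      by (intro AE_I2) (auto simp: space_pair_measure indicator_def)
  qed auto
  have "(LINT x:{a..b}|lborel. Im (borel_transform M (Complex x e)))
      = (\<integral>x. \<integral>t. ?k t x \<partial>M \<partial>lborel)"
    using e unfolding set_lebesgue_integral_def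
    by (subst Im_borel_transform, simp) (simp only: integral_scaleR_right)
  also have "\<dots> = (\<integral>t. \<integral>x. ?k t x \<partial>lborel \<partial>M)"
    by (rule P.Fubini_integral[OF int])
  also have "\<dots> = (\<integral>t. arctan ((b - t) / e) - arctan ((a - t) / e) \<partial>M)"
  proof (rule Bochner_Integration.integral_cong[OF refl])
    fix t
    have si: "set_integrable lborel {a..b} (\<lambda>x. e / ((t - x)\<^sup>2 + e\<^sup>2))"
      using e by (intro borel_integrable_atLeastAtMost' continuous_intros) (auto simp: add_nonneg_eq_0_iff)
    show "(\<integral>x. ?k t x \<partial>lborel) = arctan ((b - t) / e) - arctan ((a - t) / e)"
      using set_borel_integral_eq_integral(2)[OF si] integral_unique[OF integral_cauchy_kernel[OF e ab]]
      by (simp add: set_lebesgue_integral_def)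
  qed
  finally show ?thesis .
qed

lemma arctan_scaled_limit:
  "(\<lambda>k. arctan (c / inverse (real (Suc k)))) \<longlonglongrightarrow> pi / 2 * sgn c"
proof -
  consider "c > 0" | "c = 0" | "c < 0" by linarith
  then show ?thesis
  proof cases
    case 1 then show ?thesis by simp real_asymp
  next
    case 3 then show ?thesis by simp real_asymp
  qed simp
qed

text \<open>
By Fubini the left side integrates a difference of two arctangents against the measure. In the limit it counts
interior points fully and the two end points by half, which is the average of the open and the closed interval.
\<close>
lemma (in finite_borel_measure) stieltjes_inversion:
  assumes ab: "a < b"
  shows "(\<lambda>k. LINT x:{a..b}|lborel. Im (borel_transform M (Complex x (inverse (real (Suc k))))))
     \<longlonglongrightarrow> pi / 2 * (measure M {a<..<b} + measure M {a..b})"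
proof -
  note M_is_borel[measurable_cong]
  let ?e = "\<lambda>k. inverse (real (Suc k))"
  have "(\<lambda>k. \<integral>t. arctan ((b - t) / ?e k) - arctan ((a - t) / ?e k) \<partial>M)
     \<longlonglongrightarrow> (\<integral>t. pi / 2 * (indicator {a<..<b} t + indicator {a..b} t) \<partial>M)"
  proof (rule integral_dominated_convergence[where w="\<lambda>_. pi"])
    show "AE t in M. (\<lambda>k. arctan ((b - t) / ?e k) - arctan ((a - t) / ?e k))
        \<longlonglongrightarrow> pi / 2 * (indicator {a<..<b} t + indicator {a..b} t)"
    proof (rule AE_I2)
      fix t
      have "(\<lambda>k. arctan ((b - t) / ?e k) - arctan ((a - t) / ?e k))
         \<longlonglongrightarrow> pi / 2 * sgn (b - t) - pi / 2 * sgn (a - t)"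
        by (intro tendsto_diff arctan_scaled_limit)
      also have "pi / 2 * sgn (b - t) - pi / 2 * sgn (a - t)
          = pi / 2 * (indicator {a<..<b} t + indicator {a..b} t)"
        using ab by (auto simp: sgn_if split: split_indicator)
      finally show "(\<lambda>k. arctan ((b - t) / ?e k) - arctan ((a - t) / ?e k))
        \<longlonglongrightarrow> pi / 2 * (indicator {a<..<b} t + indicator {a..b} t)" .
    qed
    show "AE t in M. norm (arctan ((b - t) / ?e k) - arctan ((a - t) / ?e k)) \<le> pi" for k
    proof (rule AE_I2)
      fix t
      show "norm (arctan ((b - t) / ?e k) - arctan ((a - t) / ?e k)) \<le> pi"
        using arctan_bounded[of "(b - t) / ?e k"] arctan_bounded[of "(a - t) / ?e k"]
        unfolding real_norm_def by linarith
    qed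
  qed auto
  also have "(\<integral>t. pi / 2 * (indicator {a<..<b} t + indicator {a..b} t) \<partial>M)
      = pi / 2 * (measure M {a<..<b} + measure M {a..b})"
  proof -
    have i: "integrable M (indicator A :: real \<Rightarrow> real)" if "A \<in> sets borel" for A
      using that by (intro integrable_real_indicator) (auto simp: M_is_borel emeasure_eq_measure)
    show ?thesis
      using Bochner_Integration.integral_add[OF i[of "{a<..<b}"] i[of "{a..b}"]]
      by (simp add: borel_UNIV)
  qed
  finally show ?thesis
    using integral_Im_borel_transform[OF _ less_imp_le[OF ab]] by simp
qed

lemma borel_transform_unique:
  assumes "finite_borel_measure \<mu>" "finite_borel_measure \<nu>"
    and eq: "\<And>z. Im z > 0 \<Longrightarrow> borel_transform \<mu> z = borel_transform \<nu> z"
  shows "\<mu> = \<nu>"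
proof -
  interpret \<mu>: finite_borel_measure \<mu> by fact
  interpret \<nu>: finite_borel_measure \<nu> by fact
  have pt: "measure \<mu> {a} = measure \<nu> {a}" for a
    using LIMSEQ_unique[OF \<mu>.point_mass_limit[of a]] \<nu>.point_mass_limit[of a]
    by (simp add: eq)
  have avg: "measure \<mu> {a<..<b} + measure \<mu> {a..b} = measure \<nu> {a<..<b} + measure \<nu> {a..b}" if "a < b" for a b
  proof -
    have "(LINT x:{a..b}|lborel. Im (borel_transform \<nu> (Complex x (inverse (real (Suc k))))))
        = (LINT x:{a..b}|lborel. Im (borel_transform \<mu> (Complex x (inverse (real (Suc k))))))" for k
      by (simp add: eq)
    from LIMSEQ_unique[OF \<mu>.stieltjes_inversion[OF that] \<nu>.stieltjes_inversion[OF that, unfolded this]]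
    have "pi / 2 * (measure \<mu> {a<..<b} + measure \<mu> {a..b}) = pi / 2 * (measure \<nu> {a<..<b} + measure \<nu> {a..b})" .
    then show ?thesis by simp
  qed
  have Icc: "measure \<kappa> {a..b} = measure \<kappa> {a<..<b} + measure \<kappa> {a} + measure \<kappa> {b}"
    if "finite_borel_measure \<kappa>" "a < b" for \<kappa> and a b :: real
  proof -
    interpret finite_borel_measure \<kappa> by fact
    have ab: "{a<..<b} \<union> {a, b} = {a..b}" "{a} \<union> {b} = {a, b}" using that by auto
    have m: "A \<in> sets \<kappa>" if "A \<in> sets borel" for A using that by (rule sets_M)
    have "measure \<kappa> {a..b} = measure \<kappa> {a<..<b} + measure \<kappa> {a, b}"
      unfolding ab(1)[symmetric] by (rule finite_measure_Union) (auto intro!: m)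
    moreover have "measure \<kappa> {a, b} = measure \<kappa> {a} + measure \<kappa> {b}"
      unfolding ab(2)[symmetric] using that by (intro finite_measure_Union m) auto
    ultimately show ?thesis by linarith
  qed
  have Ioo: "measure \<mu> {a<..<b} = measure \<nu> {a<..<b}" if "a < b" for a b
    using avg[OF that] Icc[OF assms(1) that] Icc[OF assms(2) that] pt[of a] pt[of b] by linarith
  show ?thesis
  proof (rule measure_eqI_lessThan[OF \<mu>.M_is_borel \<nu>.M_is_borel])
    show "emeasure \<mu> {x<..} < \<infinity>" for x by (simp add: \<mu>.emeasure_eq_measure)
    fix x :: real
    have un: "(\<Union>n. {x<..<x + real (Suc n)}) = {x<..}"
    proof (intro equalityI subsetI)
      fix y assume "y \<in> {x<..}"
      moreover obtain n where "y - x < real n" using reals_Archimedean2 by blast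
      ultimately show "y \<in> (\<Union>n. {x<..<x + real (Suc n)})"
        by (auto intro!: exI[of _ n])
    qed auto
    have lim: "(\<lambda>n. measure \<kappa> {x<..<x + real (Suc n)}) \<longlonglongrightarrow> measure \<kappa> {x<..}"
      if "finite_borel_measure \<kappa>" for \<kappa>
    proof -
      interpret finite_borel_measure \<kappa> by fact
      have "range (\<lambda>n. {x<..<x + real (Suc n)}) \<subseteq> sets \<kappa>"
        by (auto intro!: sets_M)
      moreover have "incseq (\<lambda>n. {x<..<x + real (Suc n)})"
        by (auto simp: incseq_def)
      ultimately show ?thesis
        using finite_Lim_measure_incseq unfolding un[symmetric] by blast
    qed
    have "measure \<nu> {x<..<x + real (Suc n)} = measure \<mu> {x<..<x + real (Suc n)}" for n
      using Ioo[of x "x + real (Suc n)"] by simp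
    from LIMSEQ_unique[OF lim[OF assms(1)] lim[OF assms(2), unfolded this]]
    have "measure \<mu> {x<..} = measure \<nu> {x<..}" .
    then show "emeasure \<mu> {x<..} = emeasure \<nu> {x<..}"
      by (simp add: \<mu>.emeasure_eq_measure \<nu>.emeasure_eq_measure)
  qed
qed

lemma continuous_on_recur [continuous_intros]:
  fixes f :: "real \<Rightarrow> real"
  assumes "continuous_on A f"
  shows "continuous_on A (\<lambda>E. recur b (f E) x y n)"
  by (induction n rule: induct_nat_012) (auto intro!: continuous_intros assms)

section \<open>Carmona's measures\<close>

definition dirichlet_sq :: "(nat \<Rightarrow> real) \<Rightarrow> nat \<Rightarrow> real \<Rightarrow> real" where
  "dirichlet_sq b n E = (recur b E 0 1 n)\<^sup>2 + (recur b E 0 1 (Suc n))\<^sup>2"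

lemma continuous_on_dirichlet_sq: "continuous_on A (dirichlet_sq b n)"
  unfolding dirichlet_sq_def by (intro continuous_intros)

lemma measurable_dirichlet_sq [measurable]: "dirichlet_sq b n \<in> borel_measurable borel"
  by (intro borel_measurable_continuous_onI continuous_on_dirichlet_sq)

lemma dirichlet_sq_pos: "dirichlet_sq b n E > 0"
  using wronskian[of b E n] unfolding dirichlet_sq_def sum_power2_gt_zero_iff by auto

lemma dirichlet_sq_nonzero: "dirichlet_sq b n E \<noteq> 0"
  using dirichlet_sq_pos[of b n E] by simp

lemma Im_trunc_m_of_real: "Im (trunc_m b n (of_real E)) = 1 / dirichlet_sq b n E"
  by (simp add: Im_trunc_m_real dirichlet_sq_def)

text \<open>
The index is shifted by one because the decay of the density at infinity needs at least one site.
\<close>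
definition carmona :: "(nat \<Rightarrow> real) \<Rightarrow> nat \<Rightarrow> real measure" where
  "carmona b n = density lborel (\<lambda>E. ennreal (1 / (pi * dirichlet_sq b (Suc n) E)))"

text \<open>
On the real axis the density is, up to the factor \<open>\<pi>\<close>, the imaginary part of the truncated Weyl function, hence
\<open>|u n|\<^sup>2 \<le> |u 1|\<^sup>2\<close> for large energies, which decays quadratically. On the remaining compact interval the
density is continuous.
\<close>
lemma carmona_density_bound:
  obtains C where "\<And>x. 1 / dirichlet_sq b (Suc n) x \<le> C / (1 + x\<^sup>2)"
proof -
  define B where "B = (\<Sum>k=1..Suc n. \<bar>b k\<bar>)"
  have B: "\<bar>b k\<bar> \<le> B" if "1 \<le> k" "k \<le> Suc n" for k
    unfolding B_def using that by (intro member_le_sum) auto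
  have B0: "B \<ge> 0" unfolding B_def by (intro sum_nonneg) auto
  let ?I = "{- (2*B+4) .. 2*B+4}"
  have "continuous_on ?I (\<lambda>x. (1 + x\<^sup>2) / dirichlet_sq b (Suc n) x)"
    using dirichlet_sq_pos[of b "Suc n"]
    by (intro continuous_intros continuous_on_dirichlet_sq) (auto simp: less_le)
  then have "bounded ((\<lambda>x. (1 + x\<^sup>2) / dirichlet_sq b (Suc n) x) ` ?I)"
    by (intro compact_imp_bounded compact_continuous_image) simp_all
  then obtain D where D: "\<And>x. x \<in> ?I \<Longrightarrow> norm ((1 + x\<^sup>2) / dirichlet_sq b (Suc n) x) \<le> D"
    unfolding bounded_iff by blast
  \<comment> \<open>Outside the interval \<open>\<bar>x\<bar> - B - 1 \<ge> \<bar>x\<bar> / 2\<close> and \<open>1 + x\<^sup>2 \<le> 2 x\<^sup>2\<close>, whence the constant \<open>8\<close>.\<close>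
  have "1 / dirichlet_sq b (Suc n) x \<le> max D 8 / (1 + x\<^sup>2)" for x
  proof (cases "x \<in> ?I")
    case True
    have "1 + x\<^sup>2 > 0" by (simp add: add_pos_nonneg)
    moreover have "(1 + x\<^sup>2) / dirichlet_sq b (Suc n) x \<le> max D 8"
      using D[OF True] by (metis abs_le_D1 le_max_iff_disj real_norm_def)
    ultimately show ?thesis by (simp add: pos_le_divide_eq)
  next
    case False
    then have x: "\<bar>x\<bar> \<ge> 2*B + 4" by auto
    let ?z = "complex_of_real x" and ?u = "recur b (complex_of_real x) (-1) (trunc_m b (Suc n) (complex_of_real x))"
    have "1 / dirichlet_sq b (Suc n) x = (cmod (?u (Suc n)))\<^sup>2"
      using trunc_energy[of ?z b "Suc n"] by (simp add: Im_trunc_m_of_real)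
    also have "\<dots> \<le> (1 / (\<bar>x\<bar> - B - 1))\<^sup>2"
      using trunc_decay[of ?z B "Suc n" b] B x B0 by (intro power_mono) auto
    also have "\<dots> \<le> (2 / \<bar>x\<bar>)\<^sup>2"
      using x B0 by (intro power_mono) (auto simp: divide_simps)
    also have "\<dots> = 4 / x\<^sup>2" by (simp add: power_divide)
    also have "\<dots> \<le> 8 / (1 + x\<^sup>2)"
    proof -
      have "x\<^sup>2 \<ge> 1" using x B0 abs_le_square_iff[of 1 x] by simp
      then have "4 / x\<^sup>2 \<le> 8 / (2 * x\<^sup>2)" "8 / (2 * x\<^sup>2) \<le> 8 / (1 + x\<^sup>2)"
        by (simp, intro divide_left_mono) (auto intro!: mult_pos_pos add_pos_nonneg)
      then show ?thesis by linarith
    qed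
    also have "\<dots> \<le> max D 8 / (1 + x\<^sup>2)" by (intro divide_right_mono) auto
    finally show ?thesis .
  qed
  then show ?thesis using that by blast
qed

lemma integrable_carmona_density: "integrable lborel (\<lambda>E. 1 / dirichlet_sq b (Suc n) E)"
proof -
  obtain C where C: "\<And>x. 1 / dirichlet_sq b (Suc n) x \<le> C / (1 + x\<^sup>2)"
    using carmona_density_bound by blast
  have "integrable lborel (\<lambda>x::real. C * inverse (1 + x\<^sup>2))"
    using integrable_inverse_1_plus_square by (simp add: set_integrable_def)
  then show ?thesis
  proof (rule Bochner_Integration.integrable_bound)
    show "AE x in lborel. norm (1 / dirichlet_sq b (Suc n) x) \<le> norm (C * inverse (1 + x\<^sup>2))"
    proof (rule AE_I2)
      fix x
      have "norm (1 / dirichlet_sq b (Suc n) x) = 1 / dirichlet_sq b (Suc n) x"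
        using dirichlet_sq_pos[of b "Suc n" x] by simp
      also have "\<dots> \<le> norm (C * inverse (1 + x\<^sup>2))" using C[of x] by (simp add: divide_inverse)
      finally show "norm (1 / dirichlet_sq b (Suc n) x) \<le> norm (C * inverse (1 + x\<^sup>2))" .
    qed
  qed simp
qed

lemma finite_borel_carmona: "finite_borel_measure (carmona b n)"
proof -
  let ?h = "\<lambda>x. 1 / pi * (1 / dirichlet_sq b (Suc n) x)"
  have h0: "?h x \<ge> 0" for x using dirichlet_sq_pos[of b "Suc n" x] by simp
  have int: "integrable lborel ?h"
    by (rule integrable_mult_right[OF integrable_carmona_density])
  have "emeasure (carmona b n) (space (carmona b n)) = (\<integral>\<^sup>+x. ennreal (?h x) \<partial>lborel)"
    unfolding carmona_def by (subst emeasure_density) auto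
  also have "\<dots> = ennreal (\<integral>x. ?h x \<partial>lborel)"
    by (rule nn_integral_eq_integral[OF int AE_I2]) (rule h0)
  finally have "emeasure (carmona b n) (space (carmona b n)) \<noteq> \<infinity>" by simp
  then have "finite_measure (carmona b n)" by (rule finite_measureI)
  then show ?thesis
    by (simp add: finite_borel_measure_def finite_borel_measure_axioms_def carmona_def)
qed

text \<open>
On the real axis write the imaginary part of the Weyl function \<open>f\<close> as \<open>(f - cnj f) / (2 \<i>)\<close>. Cauchy's formula
for the half plane gives \<open>2 \<pi> \<i> f z\<close> from \<open>f\<close>; the conjugate of \<open>f\<close> extends to the lower half plane and
contributes zero.
\<close>
lemma borel_transform_carmona:
  assumes z: "Im z > 0"
  shows "borel_transform (carmona b n) z = trunc_m b (Suc n) z"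
proof -
  define f where "f = trunc_m b (Suc n)"
  define h where "h x = 1 / dirichlet_sq b (Suc n) x" for x
  have h: "Im (f (of_real x)) = h x" for x by (simp add: f_def h_def Im_trunc_m_of_real)
  have [measurable]: "h \<in> borel_measurable borel" unfolding h_def by measurable
  have h0: "h x \<ge> 0" for x using dirichlet_sq_pos[of b "Suc n" x] by (simp add: h_def)
  let ?k = "\<lambda>x. of_real (h x) / (of_real x - z)"
  have int: "integrable lborel ?k"
  proof (rule Bochner_Integration.integrable_bound)
    show "integrable lborel (\<lambda>x. h x * (1 / \<bar>Im z\<bar>))"
      unfolding h_def by (intro integrable_mult_left integrable_carmona_density)
    show "AE x in lborel. norm (?k x) \<le> norm (h x * (1 / \<bar>Im z\<bar>))"
    proof (rule AE_I2)
      fix x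
      have "norm (?k x) = h x * cmod (1 / (of_real x - z))" using h0 by (simp add: norm_divide)
      also have "\<dots> \<le> h x * (1 / \<bar>Im z\<bar>)"
        using z h0 by (intro mult_left_mono resolvent_kernel_bound) auto
      finally show "norm (?k x) \<le> norm (h x * (1 / \<bar>Im z\<bar>))" using h0 by simp
    qed
  qed simp
  have "(\<lambda>N. LINT x:{- real N..real N}|lborel. ?k x) \<longlonglongrightarrow> (LINT x|lborel. ?k x)"
    unfolding set_lebesgue_integral_def
  proof (rule integral_dominated_convergence[where w="\<lambda>x. norm (?k x)"])
    show "AE x in lborel. (\<lambda>N. indicator {- real N..real N} x *\<^sub>R ?k x) \<longlonglongrightarrow> ?k x"
    proof (rule AE_I2)
      fix x :: real
      obtain N0 where N0: "\<bar>x\<bar> < real N0" using reals_Archimedean2 by blast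
      have "eventually (\<lambda>N. indicator {- real N..real N} x *\<^sub>R ?k x = ?k x) sequentially"
        using eventually_ge_at_top[of N0]
      proof eventually_elim
        case (elim N)
        then have "real N0 \<le> real N" by simp
        with N0 have "x \<in> {- real N..real N}" by auto
        then show ?case by simp
      qed
      then show "(\<lambda>N. indicator {- real N..real N} x *\<^sub>R ?k x) \<longlonglongrightarrow> ?k x"
        by (rule tendsto_eventually)
    qed
    show "AE x in lborel. norm (indicator {- real N..real N} x *\<^sub>R ?k x) \<le> norm (?k x)" for N
      by (intro AE_I2) (auto split: split_indicator)
  qed (use int in auto)
  moreover have "(LINT x:{- real N..real N}|lborel. ?k x) = 
     (integral {- real N..real N} (\<lambda>x. f (of_real x) / (of_real x - z))
      - cnj (integral {- real N..real N} (\<lambda>x. f (of_real x) / (of_real x - cnj z)))) / (2 * \<i>)" for N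
  proof -
    let ?I = "{- real N..real N}"
    have "continuous_on UNIV (\<lambda>x. f (of_real x))"
      unfolding f_def
      by (intro continuous_on_compose2[OF holomorphic_on_imp_continuous_on[OF trunc_m_holomorphic]] continuous_intros) auto
    then have cont: "continuous_on ?I (\<lambda>x. f (of_real x))" by (rule continuous_on_subset) simp
    have i: "(\<lambda>x. f (of_real x) / (of_real x - w)) integrable_on ?I" if "Im w \<noteq> 0" for w
      using that by (intro integrable_continuous_real continuous_intros cont) (auto simp: of_real_diff_nonzero)
    have i2: "(\<lambda>x. cnj (f (of_real x)) / (of_real x - z)) integrable_on ?I"
      using z by (intro integrable_continuous_real continuous_intros cont) (auto simp: of_real_diff_nonzero)
    have "set_integrable lborel ?I ?k"
      using int unfolding set_integrable_def by (intro integrable_mult_indicator) auto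
    then have 1: "(LINT x:?I|lborel. ?k x) = integral ?I ?k"
      by (rule set_borel_integral_eq_integral(2))
    have k_eq: "?k = (\<lambda>x. (f (of_real x) / (of_real x - z) - cnj (f (of_real x)) / (of_real x - z)) / (2 * \<i>))"
    proof
      fix x
      have "complex_of_real (h x) = (f (of_real x) - cnj (f (of_real x))) / (2 * \<i>)"
        by (simp add: complex_diff_cnj h complex_eq_iff)
      then show "?k x = (f (of_real x) / (of_real x - z) - cnj (f (of_real x)) / (of_real x - z)) / (2 * \<i>)"
        by (simp only: diff_divide_distrib[symmetric] divide_divide_eq_left mult.commute)
    qed
    have 2: "integral ?I ?k = (integral ?I (\<lambda>x. f (of_real x) / (of_real x - z)) -
        integral ?I (\<lambda>x. cnj (f (of_real x)) / (of_real x - z))) / (2 * \<i>)"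
      unfolding k_eq using i[of z] i2 z by (simp add: Henstock_Kurzweil_Integration.integral_diff)
    have 3: "integral ?I (\<lambda>x. cnj (f (of_real x)) / (of_real x - z))
        = cnj (integral ?I (\<lambda>x. f (of_real x) / (of_real x - cnj z)))"
      unfolding integral_cnj by simp
    show ?thesis unfolding 1 2 3 ..
  qed
  moreover have "(\<lambda>N. (integral {- real N..real N} (\<lambda>x. f (of_real x) / (of_real x - z))
      - cnj (integral {- real N..real N} (\<lambda>x. f (of_real x) / (of_real x - cnj z)))) / (2 * \<i>))
      \<longlonglongrightarrow> (2 * pi * \<i> * f z - cnj 0) / (2 * \<i>)"
  proof -
    define B where "B = (\<Sum>k=1..Suc n. \<bar>b k\<bar>)"
    have B: "\<bar>b k\<bar> \<le> B" if "1 \<le> k" "k \<le> Suc n" for k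
      unfolding B_def using that by (intro member_le_sum) auto
    have bd: "cmod (f w) \<le> 1 / (cmod w - B - 1)" if "cmod w \<ge> B + 2" "Im w \<ge> 0" for w
      using trunc_decay(1)[of w B "Suc n" b] that B by (simp add: f_def)
    have hol: "f holomorphic_on {w. Im w \<ge> 0}" unfolding f_def by (rule trunc_m_holomorphic)
    show ?thesis
      using half_plane_cauchy[OF hol _ bd, where z=z] half_plane_cauchy[OF hol _ bd, where z="cnj z"] z
      by (intro tendsto_intros) auto
  qed
  ultimately have lim: "(LINT x|lborel. ?k x) = pi * f z"
    by (subst LIMSEQ_unique) (auto simp: field_simps)
  have "borel_transform (carmona b n) z = (LINT x|lborel. (1 / (pi * dirichlet_sq b (Suc n) x)) *\<^sub>R (1 / (of_real x - z)))"
    unfolding borel_transform_def carmona_def using dirichlet_sq_pos[of b "Suc n"]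
    by (subst integral_density) (auto simp: less_imp_le)
  also have "\<dots> = (LINT x|lborel. (1 / of_real pi) * ?k x)"
    by (intro Bochner_Integration.integral_cong refl) (simp add: h_def scaleR_conv_of_real)
  also have "\<dots> = f z" by (subst integral_mult_right_zero, subst lim) simp
  finally show ?thesis by (simp add: f_def)
qed

section \<open>Tightness and weak limits\<close>

lemma (in finite_borel_measure) total_mass_limit:
  "(\<lambda>k. real k * Im (borel_transform M (Complex 0 (real k)))) \<longlonglongrightarrow> measure M UNIV"
proof -
  note M_is_borel[measurable_cong]
  have "(\<lambda>k. \<integral>x. (real k)\<^sup>2 / (x\<^sup>2 + (real k)\<^sup>2) \<partial>M) \<longlonglongrightarrow> (\<integral>x. 1 \<partial>M)"
  proof (rule integral_dominated_convergence[where w="\<lambda>_. 1"])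
    show "AE x in M. (\<lambda>k. (real k)\<^sup>2 / (x\<^sup>2 + (real k)\<^sup>2)) \<longlonglongrightarrow> 1"
      by (intro AE_I2) real_asymp
    have "norm (a / (c + a)) \<le> 1" if "a \<ge> 0" "c \<ge> 0" for a c :: real
      using that by (cases "a = 0") (auto simp: divide_le_eq_1)
    then show "AE x in M. norm ((real k)\<^sup>2 / (x\<^sup>2 + (real k)\<^sup>2)) \<le> 1" for k
      by (intro AE_I2) simp
  qed auto
  moreover have "real k * Im (borel_transform M (Complex 0 (real k)))
      = (\<integral>x. (real k)\<^sup>2 / (x\<^sup>2 + (real k)\<^sup>2) \<partial>M)" for k
  proof (cases "k = 0")
    case False
    then show ?thesis
      by (subst Im_borel_transform, simp, subst integral_mult_right_zero[symmetric])
         (simp add: power2_eq_square)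
  qed simp
  ultimately show ?thesis by (simp add: borel_UNIV)
qed

text \<open>
The function \<open>2 y\<^sup>2 / (x\<^sup>2 + y\<^sup>2) - 1\<close> is at most \<open>1\<close> everywhere and nonpositive outside \<open>{-y<..y}\<close>.
\<close>
lemma (in real_distribution) tail_bound:
  assumes y: "y > 0"
  shows "1 - 2 * (1 - y * Im (borel_transform M (Complex 0 y))) \<le> measure M {-y<..y}"
proof -
  let ?q = "\<lambda>x. y / (x\<^sup>2 + y\<^sup>2)"
  have q: "Im (borel_transform M (Complex 0 y)) = (\<integral>x. ?q x \<partial>M)" "integrable M ?q"
    using Im_borel_transform[of y 0] y by simp_all
  have "(\<integral>x. 2 * (y * ?q x) - 1 \<partial>M) \<le> (\<integral>x. indicator {-y<..y} x \<partial>M)"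
  proof (rule integral_mono)
    fix x
    have "2 * (y * ?q x) - 1 \<le> 0" if "x \<notin> {-y<..y}"
    proof -
      have "\<bar>y\<bar> \<le> \<bar>x\<bar>" using that y by auto
      then have "y\<^sup>2 \<le> x\<^sup>2" by (simp add: abs_le_square_iff)
      moreover have "x\<^sup>2 + y\<^sup>2 > 0" using y by (simp add: add_nonneg_pos)
      ultimately have "y\<^sup>2 / (x\<^sup>2 + y\<^sup>2) \<le> 1 / 2" by (simp add: divide_simps)
      moreover have "y * ?q x = y\<^sup>2 / (x\<^sup>2 + y\<^sup>2)" by (simp add: power2_eq_square)
      ultimately show ?thesis by linarith
    qed
    moreover have "y * ?q x \<le> 1"
      using y by (simp add: divide_simps power2_eq_square add_nonneg_pos)
    ultimately show "2 * (y * ?q x) - 1 \<le> indicator {-y<..y} x"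
      by (cases "x \<in> {-y<..y}") auto
  next
    show "integrable M (\<lambda>x. 2 * (y * ?q x) - 1)"
      by (intro Bochner_Integration.integrable_diff integrable_mult_right q(2) integrable_const)
    show "integrable M (indicator {-y<..y} :: real \<Rightarrow> real)"
      by (intro integrable_real_indicator) (auto simp: emeasure_eq_measure)
  qed
  also have "(\<integral>x. 2 * (y * ?q x) - 1 \<partial>M) = 2 * (y * (\<integral>x. ?q x \<partial>M)) - 1"
    using prob_space
    by (subst Bochner_Integration.integral_diff[OF integrable_mult_right[OF integrable_mult_right[OF q(2)]] integrable_const])
       (simp only: integral_mult_right_zero, simp)
  finally show ?thesis by (simp add: q(1) algebra_simps)
qed

lemma Im_trunc_m_asymptotic:
  assumes "y > 0" "n \<ge> 1"
  shows "\<bar>1 - y * Im (trunc_m b n (Complex 0 y))\<bar> \<le> (\<bar>b 1\<bar> + 1) / y"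
  using trunc_m_asymptotic[of "Complex 0 y" n b] assms
    abs_Re_le_cmod[of "Complex 0 y * trunc_m b n (Complex 0 y) + 1"] by simp

lemma real_distribution_carmona: "real_distribution (carmona b n)"
proof -
  interpret finite_borel_measure "carmona b n" by (rule finite_borel_carmona)
  have "(\<lambda>k. real k * Im (trunc_m b (Suc n) (Complex 0 (real k)))) \<longlonglongrightarrow> 1"
  proof (rule LIM_zero_cancel, rule Lim_null_comparison)
    show "eventually (\<lambda>k. norm (real k * Im (trunc_m b (Suc n) (Complex 0 (real k))) - 1)
        \<le> (\<bar>b 1\<bar> + 1) / real k) sequentially"
      using eventually_gt_at_top[of 0]
    proof eventually_elim
      case (elim k)
      then show ?case using Im_trunc_m_asymptotic[of "real k" "Suc n" b] by simp
    qed
    show "(\<lambda>k. (\<bar>b 1\<bar> + 1) / real k) \<longlonglongrightarrow> 0" by real_asymp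
  qed
  moreover have "real k * Im (trunc_m b (Suc n) (Complex 0 (real k)))
      = real k * Im (borel_transform (carmona b n) (Complex 0 (real k)))" for k
    by (cases "k = 0") (simp_all add: borel_transform_carmona)
  ultimately have "(\<lambda>k. real k * Im (borel_transform (carmona b n) (Complex 0 (real k)))) \<longlonglongrightarrow> 1"
    by (simp only:)
  then have "measure (carmona b n) UNIV = 1"
    by (rule LIMSEQ_unique[OF total_mass_limit])
  then have "prob_space (carmona b n)"
    by (intro prob_spaceI) (simp only: emeasure_eq_measure borel_UNIV ennreal_1)
  then show ?thesis
    using M_is_borel by (intro real_distribution.intro real_distribution_axioms.intro)
qed

lemma tight_carmona: "tight (carmona b)"
  unfolding tight_def
proof (intro conjI allI impI)
  show "real_distribution (carmona b n)" for n by (rule real_distribution_carmona)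
  fix \<epsilon> :: real assume e: "\<epsilon> > 0"
  \<comment> \<open>With this choice twice the error bound \<open>(\<bar>b 1\<bar> + 1) / y\<close> is below \<open>\<epsilon>\<close>.\<close>
  define y where "y = 2 * (\<bar>b 1\<bar> + 1) / \<epsilon> + 1"
  have y: "y > 0" using e by (simp add: y_def add_nonneg_pos)
  have small: "2 * ((\<bar>b 1\<bar> + 1) / y) < \<epsilon>"
    using e y by (simp add: y_def field_simps)
  have "measure (carmona b n) {-y<..y} > 1 - \<epsilon>" for n
  proof -
    interpret real_distribution "carmona b n" by (rule real_distribution_carmona)
    let ?q = "y * Im (trunc_m b (Suc n) (Complex 0 y))"
    have "1 - ?q \<le> (\<bar>b 1\<bar> + 1) / y"
      using Im_trunc_m_asymptotic[OF y, of "Suc n" b] abs_le_D1 by auto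
    then have "2 * (1 - ?q) \<le> 2 * ((\<bar>b 1\<bar> + 1) / y)" by (rule mult_left_mono) simp
    also note small
    finally have "1 - \<epsilon> < 1 - 2 * (1 - ?q)" by (rule diff_strict_left_mono)
    also have "\<dots> \<le> prob {-y<..y}"
      using tail_bound[OF y] y by (simp add: borel_transform_carmona)
    finally show ?thesis .
  qed
  then show "\<exists>a c. a < c \<and> (\<forall>n. measure (carmona b n) {a<..c} > 1 - \<epsilon>)"
    using y by (intro exI[of _ "-y"] exI[of _ y]) auto
qed

lemma tendsto_recur:
  fixes c :: "nat \<Rightarrow> 'a::real_normed_field"
  assumes "c \<longlonglongrightarrow> l"
  shows "(\<lambda>j. recur b z x (c j) k) \<longlonglongrightarrow> recur b z x l k"
  by (induction k rule: induct_nat_012) (auto intro!: tendsto_intros assms)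

text \<open>
Weak convergence carries the uniform \<open>\<ell>\<^sup>2\<close> bound to the limit: for fixed \<open>N\<close> only finitely many sites occur, and
the solution at each of them is a polynomial in its initial value.
\<close>
lemma weak_limit_borel_transform:
  assumes s: "strict_mono s" and \<nu>: "real_distribution \<nu>" and conv: "weak_conv_m (carmona b \<circ> s) \<nu>"
    and z: "Im z > 0"
  shows "(\<Sum>k=1..N. (cmod (recur b z (-1) (borel_transform \<nu> z) k))\<^sup>2) \<le> 1 / (Im z)\<^sup>2"
proof -
  have "(\<lambda>j. integral\<^sup>L ((carmona b \<circ> s) j) (\<lambda>x. 1 / (complex_of_real x - z)))
      \<longlonglongrightarrow> integral\<^sup>L \<nu> (\<lambda>x. 1 / (complex_of_real x - z))"
    by (rule weak_conv_imp_integral_bdd_continuous_conv[OF _ \<nu> conv _ resolvent_kernel_bound])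
       (use z in \<open>auto intro: real_distribution_carmona isCont_resolvent_kernel\<close>)
  then have "(\<lambda>j. borel_transform (carmona b (s j)) z) \<longlonglongrightarrow> borel_transform \<nu> z"
    by (simp add: borel_transform_def)
  then have lim: "(\<lambda>j. trunc_m b (Suc (s j)) z) \<longlonglongrightarrow> borel_transform \<nu> z"
    by (simp add: borel_transform_carmona[OF z])
  have "(\<lambda>j. \<Sum>k=1..N. (cmod (recur b z (-1) (trunc_m b (Suc (s j)) z) k))\<^sup>2)
      \<longlonglongrightarrow> (\<Sum>k=1..N. (cmod (recur b z (-1) (borel_transform \<nu> z) k))\<^sup>2)"
    by (intro tendsto_intros tendsto_recur lim)
  moreover have "eventually (\<lambda>j. (\<Sum>k=1..N. (cmod (recur b z (-1) (trunc_m b (Suc (s j)) z) k))\<^sup>2)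
      \<le> 1 / (Im z)\<^sup>2) sequentially"
    using eventually_ge_at_top[of N]
  proof eventually_elim
    case (elim j)
    then have "N \<le> Suc (s j)" using seq_suble[OF s, of j] by simp
    then have "(\<Sum>k=1..N. (cmod (recur b z (-1) (trunc_m b (Suc (s j)) z) k))\<^sup>2)
        \<le> (\<Sum>k=1..Suc (s j). (cmod (recur b z (-1) (trunc_m b (Suc (s j)) z) k))\<^sup>2)"
      by (intro sum_mono2) auto
    also have "\<dots> \<le> 1 / (Im z)\<^sup>2" by (rule trunc_energy_bounds(2)[OF z]) simp
    finally show ?case .
  qed
  ultimately show ?thesis by (rule tendsto_upperbound) simp
qed

section \<open>The resolvent entry and the spectral measure\<close>

lemma jacobi_delta1_iff:
  assumes "u 0 = 0"
  shows "(\<forall>n. jacobi (\<lambda>_. 1) b u n - z * u n = delta1 n)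
    \<longleftrightarrow> (\<forall>n. u (Suc n) = recur b z (-1) (u 1) (Suc n))"
proof
  assume *: "\<forall>n. jacobi (\<lambda>_. 1) b u n - z * u n = delta1 n"
  define v where "v n = (if n = 0 then -1 else u n)" for n
  have "v (Suc (Suc n)) = (z - of_real (b (Suc n))) * v (Suc n) - v n" for n
    using *[rule_format, of "Suc n"]
    by (cases n) (simp_all add: v_def jacobi_def delta1_def numeral_2_eq_2 algebra_simps)
  then have "v n = recur b z (v 0) (v (Suc 0)) n" for n by (rule recur_unique)
  then have v: "v (Suc n) = recur b z (v 0) (v (Suc 0)) (Suc n)" for n .
  show "\<forall>n. u (Suc n) = recur b z (-1) (u 1) (Suc n)"
  proof
    fix n show "u (Suc n) = recur b z (-1) (u 1) (Suc n)" using v[of n] by (simp add: v_def)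
  qed
next
  assume *: "\<forall>n. u (Suc n) = recur b z (-1) (u 1) (Suc n)"
  show "\<forall>n. jacobi (\<lambda>_. 1) b u n - z * u n = delta1 n"
  proof
    fix n
    consider "n = 0" | "n = 1" | m where "n = Suc (Suc m)" by (metis One_nat_def not0_implies_Suc)
    then show "jacobi (\<lambda>_. 1) b u n - z * u n = delta1 n"
    proof cases
      case 1 then show ?thesis by (simp add: jacobi_def delta1_def assms)
    next
      case 2
      then show ?thesis using *[rule_format, of 1]
        by (simp add: jacobi_def delta1_def numeral_2_eq_2 algebra_simps)
    next
      case 3
      have "u (Suc (Suc (Suc m))) = (z - of_real (b (Suc (Suc m)))) * u (Suc (Suc m)) - u (Suc m)"
        unfolding *[rule_format, of m] *[rule_format, of "Suc m"] *[rule_format, of "Suc (Suc m)"]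
        by (rule recur.simps)
      with 3 show ?thesis by (simp add: jacobi_def delta1_def algebra_simps)
    qed
  qed
qed

lemma ell2_tendsto_0: "u \<in> ell2 \<Longrightarrow> u \<longlonglongrightarrow> 0"
proof -
  assume "u \<in> ell2"
  then have "(\<lambda>n. (cmod (u n))\<^sup>2) \<longlonglongrightarrow> 0" by (auto simp: ell2_def dest: summable_LIMSEQ_zero)
  then have "(\<lambda>n. sqrt ((cmod (u n))\<^sup>2)) \<longlonglongrightarrow> sqrt 0" by (rule tendsto_real_sqrt)
  then show ?thesis by (simp add: tendsto_norm_zero_iff)
qed

text \<open>
The limit point property. The difference of two decaying solutions starts from \<open>(0, c - d)\<close>; Green's identity
bounds \<open>|Im z| |c - d|\<^sup>2\<close> by the boundary term at \<open>n\<close>, which tends to zero.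
\<close>
lemma limit_point:
  assumes z: "Im z \<noteq> 0"
    and lim: "(\<lambda>n. recur b z (-1) c n) \<longlonglongrightarrow> 0" "(\<lambda>n. recur b z (-1) d n) \<longlonglongrightarrow> 0"
  shows "c = d"
proof -
  let ?w = "recur b z 0 (c - d)"
  have w: "?w n = recur b z (-1) c n - recur b z (-1) d n" for n
    unfolding recur_linear[of b z 0 "c - d" n] recur_linear[of b z "-1" c n] recur_linear[of b z "-1" d n]
    by (simp add: algebra_simps)
  have w0: "?w \<longlonglongrightarrow> 0" using tendsto_diff[OF lim] unfolding w[symmetric] by simp
  then have "(\<lambda>n. ?w (Suc n)) \<longlonglongrightarrow> 0" by (rule LIMSEQ_Suc)
  with w0 have prod: "(\<lambda>n. cmod (?w n) * cmod (?w (Suc n))) \<longlonglongrightarrow> 0 * 0"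
    by (intro tendsto_mult tendsto_norm_zero)
  have "\<bar>Im z\<bar> * (cmod (c - d))\<^sup>2 \<le> cmod (?w n) * cmod (?w (Suc n))" if "n \<ge> 1" for n
  proof -
    have "(cmod (?w 1))\<^sup>2 \<le> (\<Sum>k=1..n. (cmod (?w k))\<^sup>2)" using that by (intro member_le_sum) auto
    then have "\<bar>Im z\<bar> * (cmod (c - d))\<^sup>2 \<le> \<bar>Im z\<bar> * (\<Sum>k=1..n. (cmod (?w k))\<^sup>2)"
      by (intro mult_left_mono) auto
    also have "\<dots> = \<bar>Im (cnj (?w n) * ?w (Suc n))\<bar>"
      unfolding green_identity by (simp add: abs_mult sum_nonneg)
    also have "\<dots> \<le> cmod (cnj (?w n) * ?w (Suc n))" by (rule abs_Im_le_cmod)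
    finally show ?thesis by (simp only: norm_mult complex_mod_cnj)
  qed
  then have "eventually (\<lambda>n. \<bar>Im z\<bar> * (cmod (c - d))\<^sup>2 \<le> cmod (?w n) * cmod (?w (Suc n))) sequentially"
    by (rule eventually_sequentiallyI[of 1])
  then have "\<bar>Im z\<bar> * (cmod (c - d))\<^sup>2 \<le> 0 * 0"
    by (rule tendsto_lowerbound[OF prod]) simp
  then show ?thesis using z by (simp add: mult_le_0_iff)
qed

text \<open>
The solution with value \<open>c\<close> at site \<open>1\<close> is square summable by the premise, and so is its image under \<open>J\<close>, which
differs from \<open>z u\<close> by \<open>\<delta>\<^sub>1\<close> only. The limit point property makes it the only element of the domain that
solves the equation.
\<close>
lemma jacobi_resolvent_entry:
  assumes z: "Im z \<noteq> 0"
    and l2: "\<And>N. (\<Sum>k=1..N. (cmod (recur b z (-1) c k))\<^sup>2) \<le> B"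
  shows "ell2_inner delta1 (jacobi_resolvent (\<lambda>_. 1) b z delta1) = c"
proof -
  define u where "u n = (if n = 0 then 0 else recur b z (-1) c n)" for n
  have sq: "summable (\<lambda>n. (cmod (u n))\<^sup>2)"
  proof (rule summableI_nonneg_bounded)
    fix n
    have "(\<Sum>k<n. (cmod (u k))\<^sup>2) \<le> (\<Sum>k\<in>insert 0 {1..n}. (cmod (u k))\<^sup>2)"
      by (intro sum_mono2) auto
    also have "\<dots> = (\<Sum>k=1..n. (cmod (recur b z (-1) c k))\<^sup>2)"
      by (simp add: u_def)
    also have "\<dots> \<le> B" by (rule l2)
    finally show "(\<Sum>k<n. (cmod (u k))\<^sup>2) \<le> B" .
  qed simp
  then have u: "u \<in> ell2" by (simp add: ell2_def u_def)
  have eq: "\<forall>n. jacobi (\<lambda>_. 1) b u n - z * u n = delta1 n"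
    by (subst jacobi_delta1_iff) (simp_all add: u_def)
  have dom: "u \<in> jacobi_domain (\<lambda>_. 1) b"
  proof -
    have *: "jacobi (\<lambda>_. 1) b u n = z * u n + delta1 n" for n
      using eq[rule_format, of n] by (simp add: algebra_simps)
    have "summable (\<lambda>n. (cmod (jacobi (\<lambda>_. 1) b u n))\<^sup>2)"
    proof (rule summable_comparison_test_ev)
      show "summable (\<lambda>n. (cmod z)\<^sup>2 * (cmod (u n))\<^sup>2)" by (intro summable_mult sq)
      show "\<forall>\<^sub>F n in sequentially. norm ((cmod (jacobi (\<lambda>_. 1) b u n))\<^sup>2) \<le> (cmod z)\<^sup>2 * (cmod (u n))\<^sup>2"
        using eventually_gt_at_top[of 1]
        by eventually_elim (simp add: * delta1_def norm_mult power_mult_distrib)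
    qed
    moreover have "jacobi (\<lambda>_. 1) b u 0 = 0" by (simp add: jacobi_def)
    ultimately show ?thesis using u by (simp add: jacobi_domain_def ell2_def)
  qed
  have tends: "(\<lambda>n. recur b z (-1) (v 1) n) \<longlonglongrightarrow> 0"
    if "v \<in> ell2" "\<forall>n. v (Suc n) = recur b z (-1) (v 1) (Suc n)" for v
    using LIMSEQ_Suc[OF ell2_tendsto_0[OF that(1)], unfolded that(2)[rule_format]]
    by (rule LIMSEQ_imp_Suc)
  have "jacobi_resolvent (\<lambda>_. 1) b z delta1 = u"
    unfolding jacobi_resolvent_def
  proof (rule the_equality)
    show "u \<in> jacobi_domain (\<lambda>_. 1) b \<and> (\<forall>n. jacobi (\<lambda>_. 1) b u n - z * u n = delta1 n)"
      using dom eq by blast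
    fix v
    assume "v \<in> jacobi_domain (\<lambda>_. 1) b \<and> (\<forall>n. jacobi (\<lambda>_. 1) b v n - z * v n = delta1 n)"
    then have v: "v \<in> ell2" "v 0 = 0" "\<forall>n. jacobi (\<lambda>_. 1) b v n - z * v n = delta1 n"
      by (auto simp: jacobi_domain_def ell2_def)
    then have vr: "\<forall>n. v (Suc n) = recur b z (-1) (v 1) (Suc n)" by (subst (asm) jacobi_delta1_iff)
    have ur: "\<forall>n. u (Suc n) = recur b z (-1) (u 1) (Suc n)" by (simp add: u_def)
    have "v 1 = u 1" by (rule limit_point[OF z tends[OF v(1) vr] tends[OF u ur]])
    show "v = u"
    proof
      fix n show "v n = u n"
      proof (cases n)
        case (Suc k)
        then show ?thesis by (simp only: vr[rule_format, of k] ur[rule_format, of k] \<open>v 1 = u 1\<close>)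
      qed (simp add: v(2) u_def)
    qed
  qed
  moreover have "ell2_inner delta1 u = c"
  proof -
    have "ell2_inner delta1 u = (\<Sum>n\<in>{1}. cnj (delta1 n) * u n)"
      unfolding ell2_inner_def by (rule suminf_finite) (auto simp: delta1_def)
    then show ?thesis by (simp add: delta1_def u_def)
  qed
  ultimately show ?thesis by simp
qed

lemma weak_limit_resolvent:
  assumes "strict_mono s" and "real_distribution \<nu>" and "weak_conv_m (carmona b \<circ> s) \<nu>"
    and z: "Im z \<noteq> 0"
  shows "borel_transform \<nu> z = ell2_inner delta1 (jacobi_resolvent (\<lambda>_. 1) b z delta1)"
proof (cases "Im z > 0")
  case True
  then show ?thesis
    using jacobi_resolvent_entry[OF z weak_limit_borel_transform[OF assms(1-3) True]] by simp
next
  case False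
  then have z': "Im (cnj z) > 0" using z by simp
  have "recur b z (-1) (borel_transform \<nu> z) k = cnj (recur b (cnj z) (-1) (borel_transform \<nu> (cnj z)) k)" for k
    using recur_cnj[of b "cnj z" "-1" "borel_transform \<nu> (cnj z)" k] by (simp add: borel_transform_cnj)
  then have "(\<Sum>k=1..N. (cmod (recur b z (-1) (borel_transform \<nu> z) k))\<^sup>2) \<le> 1 / (Im (cnj z))\<^sup>2" for N
    using weak_limit_borel_transform[OF assms(1-3) z', of N] by simp
  from jacobi_resolvent_entry[OF z this] show ?thesis by simp
qed

lemma spectral_measure_eqI:
  assumes "finite_borel_measure \<nu>"
    and "\<And>z. Im z \<noteq> 0 \<Longrightarrow> borel_transform \<nu> z = ell2_inner delta1 (jacobi_resolvent a b z delta1)"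
  shows "spectral_measure a b = \<nu>"
  unfolding spectral_measure_def
proof (rule the_equality)
  show "sets \<nu> = sets borel \<and> finite_measure \<nu> \<and> (\<forall>z. Im z \<noteq> 0 \<longrightarrow>
      (\<integral>x. 1 / (complex_of_real x - z) \<partial>\<nu>) = ell2_inner delta1 (jacobi_resolvent a b z delta1))"
    using assms by (auto simp: borel_transform_def finite_borel_measure_def finite_borel_measure_axioms_def)
  fix \<mu> :: "real measure"
  assume \<mu>: "sets \<mu> = sets borel \<and> finite_measure \<mu> \<and> (\<forall>z. Im z \<noteq> 0 \<longrightarrow>
      (\<integral>x. 1 / (complex_of_real x - z) \<partial>\<mu>) = ell2_inner delta1 (jacobi_resolvent a b z delta1))"
  show "\<mu> = \<nu>"
  proof (rule borel_transform_unique)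
    show "finite_borel_measure \<mu>"
      using \<mu> by (auto simp: finite_borel_measure_def finite_borel_measure_axioms_def)
    show "borel_transform \<mu> z = borel_transform \<nu> z" if "Im z > 0" for z
      using \<mu> that assms(2)[of z] by (auto simp: borel_transform_def)
  qed (rule assms(1))
qed

text \<open>
Helly's theorem provides a limit along some subsequence, so the spectral measure exists. Every other weak limit of
a subsequence has the same Borel transform and therefore agrees with it, so the whole sequence converges.
\<close>
theorem carmona_weak_convergence:
  shows "real_distribution (spectral_measure (\<lambda>_. 1) b)"
    and "weak_conv_m (carmona b) (spectral_measure (\<lambda>_. 1) b)"
proof -
  have lim: "spectral_measure (\<lambda>_. 1) b = \<nu>"
    if "strict_mono s" "real_distribution \<nu>" "weak_conv_m (carmona b \<circ> s) \<nu>" for s \<nu>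
    using weak_limit_resolvent[OF that]
    by (intro spectral_measure_eqI real_distribution.finite_borel_measure_M that(2))
  have "strict_mono (id :: nat \<Rightarrow> nat)" by (simp add: strict_mono_def)
  then obtain r \<nu> where "strict_mono (r :: nat \<Rightarrow> nat)" "real_distribution \<nu>" "weak_conv_m (carmona b \<circ> r) \<nu>"
    using tight_imp_convergent_subsubsequence[OF tight_carmona, of id b] unfolding o_id by blast
  then show rd: "real_distribution (spectral_measure (\<lambda>_. 1) b)"
    using lim[of r \<nu>] by simp
  show "weak_conv_m (carmona b) (spectral_measure (\<lambda>_. 1) b)"
    by (rule tight_subseq_weak_converge[OF real_distribution_carmona rd tight_carmona]) (use lim in blast)
qed

section \<open>Lower bounds for the spectral measure\<close>

text \<open>
One half of the portmanteau theorem: the indicator of a closed set is a decreasing limit of bounded continuous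
functions of the distance to the set.
\<close>
lemma weak_conv_closed_lower_bound:
  fixes F :: "real set"
  assumes \<mu>: "\<And>n. real_distribution (\<mu> n)" and M: "real_distribution M" and conv: "weak_conv_m \<mu> M"
    and F: "closed F" and freq: "\<exists>\<^sub>F n in sequentially. c \<le> measure (\<mu> n) F"
  shows "c \<le> measure M F"
proof (cases "F = {}")
  case True
  then show ?thesis using freq by (auto dest: frequently_ex)
next
  case False
  interpret M: real_distribution M by (rule M)
  have [measurable]: "F \<in> sets borel" using F by simp
  define \<phi> where "\<phi> k x = max 0 (1 - real k * infdist x F)" for k x
  have cont: "isCont (\<phi> k) x" for k x
    unfolding \<phi>_def by (intro continuous_intros)
  have meas [measurable]: "\<phi> k \<in> borel_measurable borel" for k
    by (intro borel_measurable_continuous_onI continuous_at_imp_continuous_on ballI cont)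
  have bound: "norm (\<phi> k x) \<le> 1" "\<phi> k x \<ge> 0" for k x
    using infdist_nonneg[of x F] by (auto simp: \<phi>_def)
  have one: "\<phi> k x = 1" if "x \<in> F" for k x using that by (simp add: \<phi>_def)
  have c_le: "c \<le> (\<integral>x. \<phi> k x \<partial>M)" for k
  proof (rule ccontr)
    assume "\<not> ?thesis"
    moreover have "(\<lambda>n. \<integral>x. \<phi> k x \<partial>\<mu> n) \<longlonglongrightarrow> (\<integral>x. \<phi> k x \<partial>M)"
      using weak_conv_imp_integral_bdd_continuous_conv[OF \<mu> M conv, of "\<phi> k" 1] cont bound by blast
    ultimately have "eventually (\<lambda>n. (\<integral>x. \<phi> k x \<partial>\<mu> n) < c) sequentially"
      by (auto intro: order_tendstoD(2))
    from frequently_ex[OF frequently_eventually_frequently[OF freq this]]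
    obtain n where n: "(\<integral>x. \<phi> k x \<partial>\<mu> n) < c" "c \<le> measure (\<mu> n) F" by blast
    interpret N: real_distribution "\<mu> n" by (rule \<mu>)
    have "measure (\<mu> n) F = (\<integral>x. indicator F x \<partial>\<mu> n)" using F by (simp add: N.borel_UNIV)
    also have "\<dots> \<le> (\<integral>x. \<phi> k x \<partial>\<mu> n)"
    proof (rule integral_mono)
      show "integrable (\<mu> n) (indicator F :: real \<Rightarrow> real)"
        using F by (intro integrable_real_indicator) (auto simp: N.emeasure_eq_measure)
      show "integrable (\<mu> n) (\<phi> k)"
        using bound by (intro N.integrable_const_bound[where B=1]) auto
      show "indicator F x \<le> \<phi> k x" for x using one[of x k] bound(2)[of k x] by (auto simp: indicator_def)
    qed
    finally show False using n by simp
  qed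
  have "(\<lambda>k. \<integral>x. \<phi> k x \<partial>M) \<longlonglongrightarrow> (\<integral>x. indicator F x \<partial>M)"
  proof (rule integral_dominated_convergence[where w="\<lambda>_. 1"])
    show "AE x in M. (\<lambda>k. \<phi> k x) \<longlonglongrightarrow> indicator F x"
    proof (rule AE_I2)
      fix x
      show "(\<lambda>k. \<phi> k x) \<longlonglongrightarrow> indicator F x"
      proof (cases "x \<in> F")
        case True then show ?thesis by (simp add: one)
      next
        case out: False
        then have "infdist x F > 0"
          using in_closed_iff_infdist_zero[OF F False, of x] infdist_nonneg[of x F] by auto
        then obtain k0 where k0: "1 < real k0 * infdist x F" using reals_Archimedean3 by blast
        have "eventually (\<lambda>k. \<phi> k x = 0) sequentially"
          using eventually_ge_at_top[of k0]
        proof eventually_elim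
          case (elim k)
          then have "real k0 * infdist x F \<le> real k * infdist x F"
            by (intro mult_right_mono) (auto simp: infdist_nonneg)
          then show ?case using k0 by (simp add: \<phi>_def)
        qed
        then show ?thesis using out by (simp add: tendsto_eventually)
      qed
    qed
    show "AE x in M. norm (\<phi> k x) \<le> 1" for k using bound(1) by simp
  qed auto
  then have "c \<le> (\<integral>x. indicator F x \<partial>M)"
    by (rule tendsto_lowerbound) (use c_le in auto)
  then show ?thesis using F by (simp add: M.borel_UNIV)
qed

text \<open>
A quantitative Cauchy--Schwarz inequality, obtained by integrating \<open>1 / g \<ge> 2 s - s\<^sup>2 g\<close> over \<open>F\<close> and
choosing \<open>s = |F| / L\<close>.
\<close>
lemma carmona_compact_lower_bound:
  assumes F: "compact F" and L: "L > 0"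
    and bd: "(\<integral>\<^sup>+E\<in>F. ennreal (dirichlet_sq b (Suc n) E) \<partial>lborel) \<le> ennreal L"
  shows "(measure lborel F)\<^sup>2 / (pi * L) \<le> measure (carmona b n) F"
proof -
  let ?g = "dirichlet_sq b (Suc n)"
  interpret real_distribution "carmona b n" by (rule real_distribution_carmona)
  have Fb [measurable]: "F \<in> sets borel" using F by (rule borel_compact)
  have ig: "set_integrable lborel F ?g"
    unfolding set_integrable_def by (intro borel_integrable_compact F continuous_on_dirichlet_sq)
  have iF: "integrable lborel (indicator F :: real \<Rightarrow> real)"
    using F emeasure_compact_finite[OF F] by (intro integrable_real_indicator) auto
  have iinv: "set_integrable lborel F (\<lambda>x. 1 / (pi * ?g x))"
    unfolding set_integrable_def
    by (intro borel_integrable_compact F continuous_intros continuous_on_dirichlet_sq) (auto simp: dirichlet_sq_nonzero)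
  have gL: "(LINT x:F|lborel. ?g x) \<le> L"
  proof -
    have "ennreal (LINT x:F|lborel. ?g x) = (\<integral>\<^sup>+x. ennreal (indicator F x *\<^sub>R ?g x) \<partial>lborel)"
      unfolding set_lebesgue_integral_def using ig dirichlet_sq_pos[of b "Suc n"]
      by (intro nn_integral_eq_integral[symmetric] AE_I2) (auto simp: set_integrable_def less_imp_le)
    also have "\<dots> = (\<integral>\<^sup>+E\<in>F. ennreal (?g E) \<partial>lborel)"
      by (intro nn_integral_cong) (auto simp: indicator_def)
    finally show ?thesis using bd L by (metis ennreal_le_iff less_imp_le)
  qed
  have muF: "measure (carmona b n) F = (LINT x:F|lborel. 1 / (pi * ?g x))"
  proof -
    have "emeasure (carmona b n) F = (\<integral>\<^sup>+x. ennreal (indicator F x *\<^sub>R (1 / (pi * ?g x))) \<partial>lborel)"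
      unfolding carmona_def by (subst emeasure_density) (auto intro!: nn_integral_cong simp: indicator_def)
    also have "\<dots> = ennreal (LINT x:F|lborel. 1 / (pi * ?g x))"
      unfolding set_lebesgue_integral_def using iinv dirichlet_sq_pos[of b "Suc n"]
      by (intro nn_integral_eq_integral AE_I2) (auto simp: set_integrable_def less_imp_le)
    finally have "ennreal (measure (carmona b n) F) = ennreal (LINT x:F|lborel. 1 / (pi * ?g x))"
      by (simp only: emeasure_eq_measure)
    moreover have "(LINT x:F|lborel. 1 / (pi * ?g x)) \<ge> 0"
      unfolding set_lebesgue_integral_def using dirichlet_sq_pos[of b "Suc n"]
      by (intro integral_nonneg_AE AE_I2) (simp add: less_imp_le)
    ultimately show ?thesis by (simp only: ennreal_inj measure_nonneg)
  qed
  define s where "s = measure lborel F / L"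
  have amgm: "(2 * s - s\<^sup>2 * ?g x) / pi \<le> 1 / (pi * ?g x)" for x
  proof -
    have g: "?g x > 0" by (rule dirichlet_sq_pos)
    have "0 \<le> (s * ?g x - 1)\<^sup>2" by simp
    then have "(2 * s - s\<^sup>2 * ?g x) * ?g x \<le> 1" by (simp add: power2_eq_square algebra_simps)
    then have "2 * s - s\<^sup>2 * ?g x \<le> 1 / ?g x" using g by (simp add: pos_le_divide_eq)
    then have "(2 * s - s\<^sup>2 * ?g x) / pi \<le> (1 / ?g x) / pi" by (rule divide_right_mono) simp
    then show ?thesis by (simp add: mult.commute)
  qed
  have split: "indicator F x *\<^sub>R ((2 * s - s\<^sup>2 * ?g x) / pi)
      = (2 * s / pi) * indicator F x - (s\<^sup>2 / pi) * (indicator F x *\<^sub>R ?g x)" for x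
    by (cases "x \<in> F") (simp_all add: diff_divide_distrib)
  have i2: "integrable lborel (\<lambda>x. (2 * s / pi) * indicator F x)"
    "integrable lborel (\<lambda>x. (s\<^sup>2 / pi) * (indicator F x *\<^sub>R ?g x))"
    using iF ig unfolding set_integrable_def by (auto intro!: integrable_mult_right)
  have "(measure lborel F)\<^sup>2 / (pi * L) = (2 * s * measure lborel F - s\<^sup>2 * L) / pi"
    using L by (simp add: s_def field_simps power2_eq_square)
  also have "\<dots> \<le> (2 * s * measure lborel F - s\<^sup>2 * (LINT x:F|lborel. ?g x)) / pi"
    using gL by (intro divide_right_mono diff_left_mono mult_left_mono) auto
  also have "\<dots> = (LINT x:F|lborel. (2 * s - s\<^sup>2 * ?g x) / pi)"
    unfolding set_lebesgue_integral_def split Bochner_Integration.integral_diff[OF i2] integral_mult_right_zero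
    by (simp add: diff_divide_distrib)
  also have "\<dots> \<le> (LINT x:F|lborel. 1 / (pi * ?g x))"
    unfolding set_lebesgue_integral_def
  proof (rule integral_mono)
    show "integrable lborel (\<lambda>x. indicator F x *\<^sub>R ((2 * s - s\<^sup>2 * ?g x) / pi))"
      unfolding split by (intro Bochner_Integration.integrable_diff i2)
    show "integrable lborel (\<lambda>x. indicator F x *\<^sub>R (1 / (pi * ?g x)))"
      using iinv unfolding set_integrable_def .
    show "indicator F x *\<^sub>R ((2 * s - s\<^sup>2 * ?g x) / pi) \<le> indicator F x *\<^sub>R (1 / (pi * ?g x))" for x
      using amgm[of x] by (intro scaleR_left_mono) auto
  qed
  finally show ?thesis using muF by simp
qed

lemma compact_subset_pos_measure:
  fixes A :: "real set"
  assumes A: "A \<in> sets borel" "bounded A" and pos: "emeasure lborel A > 0"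
  obtains F where "compact F" "F \<subseteq> A" "measure lborel F > 0"
proof -
  have fin: "emeasure lborel A < \<infinity>" by (rule emeasure_bounded_finite[OF A(2)])
  have em: "emeasure lborel B = ennreal (measure lborel B)" if "emeasure lborel B < \<infinity>" for B :: "real set"
    using that by (intro emeasure_eq_ennreal_measure) auto
  have e: "measure lborel A > 0" "emeasure lborel A = ennreal (measure lborel A)"
    using pos em[OF fin] by (metis ennreal_less_zero_iff, metis)
  obtain T where T: "closed T" "T \<subseteq> A" "emeasure lebesgue (A - T) < ennreal (measure lborel A)"
    using sets_lebesgue_inner_closed[OF _ e(1), of A] A(1) by (metis sets_completionI_sets sets_lborel)
  have [measurable]: "T \<in> sets borel" using T(1) by simp
  have cT: "compact T" using T A(2) by (auto simp: compact_eq_bounded_closed intro: bounded_subset)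
  have "emeasure lborel T \<noteq> 0"
  proof
    assume "emeasure lborel T = 0"
    have "T \<union> (A - T) = A" using T(2) by blast
    then have "emeasure lborel A \<le> emeasure lborel T + emeasure lborel (A - T)"
      using emeasure_subadditive[of T lborel "A - T"] A(1) by simp
    also have "\<dots> = emeasure lebesgue (A - T)"
      using \<open>emeasure lborel T = 0\<close> A(1) by simp
    also note T(3)
    also note e(2)[symmetric]
    finally show False by simp
  qed
  then have "measure lborel T > 0"
    using em[OF emeasure_compact_finite[OF cT]]
    by (metis ennreal_less_zero_iff zero_less_iff_neq_zero)
  then show ?thesis using that cT T(2) by blast
qed

text \<open>
The bound \<open>L\<close> and the indices at which it holds are inherited by all compact subsets of \<open>S\<close>, so one subsequence
serves every set \<open>A\<close>. By inner regularity \<open>A\<close> may be replaced by such a compact set.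
\<close>
lemma spectral_measure_positive:
  assumes S: "bounded S"
    and freq: "\<exists>\<^sub>F n in sequentially. (\<integral>\<^sup>+E\<in>S. ennreal (dirichlet_sq b (Suc n) E) \<partial>lborel) \<le> ennreal L"
    and A: "A \<in> sets borel" "A \<subseteq> S" "emeasure lborel A > 0"
  shows "emeasure (spectral_measure (\<lambda>_. 1) b) A > 0"
proof -
  let ?\<mu> = "spectral_measure (\<lambda>_. 1) b"
  interpret real_distribution ?\<mu> by (rule carmona_weak_convergence)
  obtain F where F: "compact F" "F \<subseteq> A" "measure lborel F > 0"
    using compact_subset_pos_measure[OF A(1) bounded_subset[OF S A(2)] A(3)] by blast
  \<comment> \<open>The lower bound divides by the constant, which \<open>L\<close> itself does not permit if it is nonpositive.\<close>
  define L' where "L' = max L 1"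
  have "\<exists>\<^sub>F n in sequentially. (measure lborel F)\<^sup>2 / (pi * L') \<le> measure (carmona b n) F"
    using freq
  proof (rule frequently_elim1)
    fix n assume *: "(\<integral>\<^sup>+E\<in>S. ennreal (dirichlet_sq b (Suc n) E) \<partial>lborel) \<le> ennreal L"
    have "(\<integral>\<^sup>+E\<in>F. ennreal (dirichlet_sq b (Suc n) E) \<partial>lborel)
        \<le> (\<integral>\<^sup>+E\<in>S. ennreal (dirichlet_sq b (Suc n) E) \<partial>lborel)"
      using F(2) A(2) by (intro nn_integral_mono mult_left_mono) (auto simp: indicator_def)
    also have "\<dots> \<le> ennreal L'" using * by (rule order_trans) (auto simp: L'_def intro!: ennreal_leI)
    finally show "(measure lborel F)\<^sup>2 / (pi * L') \<le> measure (carmona b n) F"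
      by (intro carmona_compact_lower_bound F(1)) (auto simp: L'_def)
  qed
  then have "(measure lborel F)\<^sup>2 / (pi * L') \<le> measure ?\<mu> F"
    by (intro weak_conv_closed_lower_bound[OF real_distribution_carmona carmona_weak_convergence]
        compact_imp_closed F(1))
  moreover have "(measure lborel F)\<^sup>2 / (pi * L') > 0" using F(3) by (simp add: L'_def)
  ultimately have "measure ?\<mu> F > 0" by linarith
  also have "measure ?\<mu> F \<le> measure ?\<mu> A"
    using F(2) A(1) by (intro finite_measure_mono) auto
  finally show ?thesis by (simp add: emeasure_eq_measure)
qed

section \<open>Absolutely continuous part and essential support\<close>

text \<open>
A countable union of null sets whose masses approach the supremum attains it. The maximal set carries the
whole singular part of the measure.
\<close>
lemma (in finite_borel_measure) maximal_null_set:
  obtains N :: "real set" where "N \<in> null_sets lborel" "\<And>A. A \<in> null_sets lborel \<Longrightarrow> measure M A \<le> measure M N"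
proof -
  let ?X = "measure M ` null_sets (lborel :: real measure)"
  have bdd: "bdd_above ?X" using bounded_measure by (auto intro!: bdd_aboveI2)
  have ne: "?X \<noteq> {}" by auto
  have "\<exists>N\<in>null_sets lborel. Sup ?X - inverse (real (Suc k)) < measure M N" for k
    using less_cSup_iff[OF ne bdd, of "Sup ?X - inverse (real (Suc k))"] by auto
  then obtain N where N: "\<And>k. N k \<in> null_sets lborel" "\<And>k. Sup ?X - inverse (real (Suc k)) < measure M (N k)"
    by metis
  define U where "U = (\<Union>k. N k)"
  have U: "U \<in> null_sets lborel" unfolding U_def by (intro null_sets_UN N)
  have "Sup ?X - inverse (real (Suc k)) \<le> measure M U" for k
  proof -
    have "measure M (N k) \<le> measure M U"
      using null_setsD2[OF U] by (intro finite_measure_mono) (auto simp: U_def M_is_borel)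
    then show ?thesis using N(2)[of k] by linarith
  qed
  moreover have "(\<lambda>k. Sup ?X - inverse (real (Suc k))) \<longlonglongrightarrow> Sup ?X - 0"
    by (intro tendsto_diff tendsto_const LIMSEQ_inverse_real_of_nat)
  ultimately have "Sup ?X \<le> measure M U" by (intro LIMSEQ_le_const2) auto
  then have "measure M A \<le> measure M U" if "A \<in> null_sets lborel" for A
    using cSup_upper[OF imageI[OF that] bdd] by linarith
  then show ?thesis using that U by blast
qed

text \<open>
The absolutely continuous part is the restriction of \<open>\<mu>\<close> to the complement of a maximal null set \<open>N\<close>: a null set
with positive mass outside \<open>N\<close> would contradict maximality. For uniqueness, two decompositions agree with
\<open>\<mu>\<close> outside the union of their two exceptional null sets, and there the absolutely continuous summands
have all their mass.
\<close>
lemma ac_part_eq_restriction: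
  assumes "finite_borel_measure \<mu>"
  obtains N where "N \<in> null_sets lborel" "ac_part \<mu> = density \<mu> (indicator (- N))"
    "absolutely_continuous lborel (ac_part \<mu>)"
proof -
  interpret finite_borel_measure \<mu> by fact
  note M_is_borel[measurable_cong, simp]
  obtain N where N: "N \<in> null_sets lborel" and max: "\<And>A. A \<in> null_sets lborel \<Longrightarrow> measure \<mu> A \<le> measure \<mu> N"
    using maximal_null_set by blast
  have Nb [measurable]: "N \<in> sets borel" using null_setsD2[OF N] by simp
  let ?\<nu> = "density \<mu> (indicator (- N))" and ?\<sigma> = "density \<mu> (indicator N)"
  have \<nu>: "emeasure ?\<nu> A = emeasure \<mu> (A - N)" if "A \<in> sets borel" for A
    using that by (subst emeasure_density) (auto simp: indicator_inter_arith[symmetric] Diff_eq Int_commute)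
  have \<sigma>: "emeasure ?\<sigma> A = emeasure \<mu> (A \<inter> N)" if "A \<in> sets borel" for A
    using that by (subst emeasure_density) (auto simp: indicator_inter_arith[symmetric] Int_commute)
  have ac: "absolutely_continuous lborel ?\<nu>"
    unfolding absolutely_continuous_def
  proof
    fix A :: "real set" assume A: "A \<in> null_sets lborel"
    then have Ab: "A \<in> sets borel" by auto
    have "A \<union> N \<in> null_sets lborel" using A N by (rule null_sets.Un)
    then have "measure \<mu> (A \<union> N) \<le> measure \<mu> N" by (rule max)
    moreover have "measure \<mu> (A \<union> N) = measure \<mu> N + measure \<mu> (A - N)"
      using finite_measure_Union[of N "A - N"] Ab Nb by (simp add: Un_commute)
    ultimately have "measure \<mu> (A - N) = 0" using measure_nonneg[of \<mu> "A - N"] by linarith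
    then show "A \<in> null_sets ?\<nu>"
      using Ab by (simp add: null_sets_def \<nu> emeasure_eq_measure)
  qed
  have "ac_part \<mu> = ?\<nu>"
    unfolding ac_part_def
  proof (rule the_equality)
    have "emeasure \<mu> A = emeasure ?\<nu> A + emeasure ?\<sigma> A" if "A \<in> sets borel" for A
      unfolding \<nu>[OF that] \<sigma>[OF that] using that
      by (subst plus_emeasure) (auto intro!: arg_cong[where f="emeasure \<mu>"])
    moreover have "(UNIV - N) \<inter> N = {}" by blast
    then have "emeasure ?\<sigma> (UNIV - N) = 0" using \<sigma>[of "UNIV - N"] Nb by (simp only: emeasure_empty) simp
    ultimately show "sets ?\<nu> = sets borel \<and> absolutely_continuous lborel ?\<nu> \<and>
        (\<exists>\<sigma>. sets \<sigma> = sets borel \<and> (\<exists>N\<in>null_sets lborel. emeasure \<sigma> (UNIV - N) = 0) \<and>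
          (\<forall>A\<in>sets borel. emeasure \<mu> A = emeasure ?\<nu> A + emeasure \<sigma> A))"
      using ac N by (intro conjI exI[of _ ?\<sigma>]) auto
    fix \<kappa> :: "real measure"
    assume \<kappa>: "sets \<kappa> = sets borel \<and> absolutely_continuous lborel \<kappa> \<and>
        (\<exists>\<sigma>. sets \<sigma> = sets borel \<and> (\<exists>N\<in>null_sets lborel. emeasure \<sigma> (UNIV - N) = 0) \<and>
          (\<forall>A\<in>sets borel. emeasure \<mu> A = emeasure \<kappa> A + emeasure \<sigma> A))"
    then obtain \<tau> N' where \<tau>: "sets \<tau> = sets borel" "N' \<in> null_sets lborel" "emeasure \<tau> (UNIV - N') = 0"
      "\<And>A. A \<in> sets borel \<Longrightarrow> emeasure \<mu> A = emeasure \<kappa> A + emeasure \<tau> A" by blast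
    have \<kappa>s: "sets \<kappa> = sets borel" and \<kappa>ac: "absolutely_continuous lborel \<kappa>" using \<kappa> by auto
    have N'b: "N' \<in> sets borel" using null_setsD2[OF \<tau>(2)] by simp
    show "\<kappa> = ?\<nu>"
    proof (rule measure_eqI)
      show "sets \<kappa> = sets ?\<nu>" using \<kappa>s by simp
      fix A assume "A \<in> sets \<kappa>"
      then have A: "A \<in> sets borel" using \<kappa>s by simp
      define D where "D = A - (N \<union> N')"
      have D: "D \<in> sets borel" using A Nb N'b by (simp add: D_def)
      have null: "A \<inter> (N \<union> N') \<in> null_sets lborel"
        using null_sets.Un[OF N \<tau>(2)] by (rule null_sets_subset) (use A Nb N'b in auto)
      \<comment> \<open>A summand that is absolutely continuous ignores the two exceptional null sets.\<close>
      have red: "emeasure \<rho> A = emeasure \<rho> D"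
        if "sets \<rho> = sets borel" "absolutely_continuous lborel \<rho>" for \<rho> :: "real measure"
      proof -
        have "A \<inter> (N \<union> N') \<in> null_sets \<rho>" using null that(2) by (auto simp: absolutely_continuous_def)
        then have "emeasure \<rho> (A - A \<inter> (N \<union> N')) = emeasure \<rho> A"
          using A that(1) by (intro emeasure_Diff_null_set) auto
        moreover have "A - A \<inter> (N \<union> N') = D" by (auto simp: D_def)
        ultimately show ?thesis by simp
      qed
      have "emeasure \<tau> D \<le> emeasure \<tau> (UNIV - N')"
        using N'b \<tau>(1) by (intro emeasure_mono) (auto simp: D_def)
      then have "emeasure \<tau> D = 0" using \<tau>(3) by simp
      then have "emeasure \<kappa> D = emeasure \<mu> D" using \<tau>(4)[OF D] by simp
      also have "\<dots> = emeasure ?\<nu> D"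
        unfolding \<nu>[OF D] by (rule arg_cong[where f="emeasure \<mu>"]) (auto simp: D_def)
      finally show "emeasure \<kappa> A = emeasure ?\<nu> A"
        using red[OF \<kappa>s \<kappa>ac] red[OF _ ac] by simp
    qed
  qed
  then show ?thesis using that N ac by simp
qed

lemma essential_support_exists:
  assumes "absolutely_continuous lborel \<nu>" "sets \<nu> = sets borel"
  obtains A where "A \<in> essential_support \<nu>"
proof -
  obtain f where f [measurable]: "f \<in> borel_measurable lborel" and \<nu>: "density lborel f = \<nu>"
    using sigma_finite_measure.Radon_Nikodym[OF sigma_finite_lborel assms(1)] assms(2) by auto
  define A where "A = {x. f x \<noteq> 0}"
  have A [measurable]: "A \<in> sets borel"
  proof -
    have "A = f -` (- {0}) \<inter> space lborel" by (auto simp: A_def)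
    also have "\<dots> \<in> sets lborel" by (rule measurable_sets[OF f]) simp
    finally show ?thesis by simp
  qed
  have "emeasure \<nu> (UNIV - A) = (\<integral>\<^sup>+x. f x * indicator (UNIV - A) x \<partial>lborel)"
    unfolding \<nu>[symmetric] by (subst emeasure_density) auto
  also have "\<dots> = (\<integral>\<^sup>+x. 0 \<partial>(lborel :: real measure))" by (intro nn_integral_cong) (auto simp: A_def indicator_def)
  finally have 1: "emeasure \<nu> (UNIV - A) = 0" by simp
  have 2: "absolutely_continuous \<nu> (density lborel (indicator A))"
    unfolding absolutely_continuous_def
  proof
    fix B assume "B \<in> null_sets \<nu>"
    then have B: "B \<in> sets borel" and ae: "AE x in lborel. x \<in> B \<longrightarrow> f x = 0"
      by (auto simp: \<nu>[symmetric] null_sets_density_iff)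
    from ae have "AE x in lborel. x \<in> B \<longrightarrow> indicator A x = (0::ennreal)"
      by eventually_elim (auto simp: A_def)
    then show "B \<in> null_sets (density lborel (indicator A))"
      using B by (simp add: null_sets_density_iff)
  qed
  have "A \<in> essential_support \<nu>" unfolding essential_support_def using A 1 2 by blast
  then show ?thesis by (rule that)
qed

lemma null_sets_density_indicator:
  assumes "A \<in> sets borel" "B \<in> sets borel"
  shows "B \<in> null_sets (density lborel (indicator A)) \<longleftrightarrow> B \<inter> A \<in> null_sets lborel"
proof -
  have "B \<inter> A \<in> null_sets lborel \<longleftrightarrow> (AE x in lborel. x \<notin> B \<inter> A)"
    using assms by (intro AE_iff_null_sets) simp
  moreover have "x \<notin> B \<inter> A \<longleftrightarrow> x \<in> B \<longrightarrow> indicator A x = (0::ennreal)" for x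
    by (auto simp: indicator_def)
  ultimately show ?thesis using assms by (subst null_sets_density_iff) auto
qed

text \<open>
The part of \<open>G\<close> missed by an essential support has no absolutely continuous mass, so it is Lebesgue null by the
positivity premise. Conversely a Borel subset of \<open>G\<close> with null complement in \<open>G\<close> becomes an essential support
when any essential support is added to it outside \<open>G\<close>.
\<close>
lemma class_Int_ac_part:
  assumes \<mu>: "finite_borel_measure \<mu>" and G: "G \<in> sets borel"
    and pos: "\<And>A. A \<in> sets borel \<Longrightarrow> A \<subseteq> G \<Longrightarrow> emeasure lborel A > 0 \<Longrightarrow> emeasure \<mu> A > 0"
  shows "class_Int (essential_support (ac_part \<mu>)) G
    = {B \<in> sets borel. B \<subseteq> G \<and> G - B \<in> null_sets lborel}"
proof -
  interpret finite_borel_measure \<mu> by fact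
  note M_is_borel[measurable_cong, simp]
  let ?\<nu> = "ac_part \<mu>"
  obtain N where N: "N \<in> null_sets lborel" and \<nu>: "?\<nu> = density \<mu> (indicator (- N))"
    and ac: "absolutely_continuous lborel ?\<nu>"
    using ac_part_eq_restriction[OF \<mu>] by blast
  have Nb [measurable]: "N \<in> sets borel" using null_setsD2[OF N] by simp
  have sets\<nu> [simp]: "sets ?\<nu> = sets borel" by (simp add: \<nu>)
  have em\<nu>: "emeasure ?\<nu> A = emeasure \<mu> (A - N)" if "A \<in> sets borel" for A
    unfolding \<nu> using that
    by (subst emeasure_density) (auto simp: indicator_inter_arith[symmetric] Diff_eq Int_commute)
  have lebesgue_null: "A \<in> null_sets lborel" if A: "A \<in> sets borel" "A \<subseteq> G" "emeasure ?\<nu> A = 0" for A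
  proof -
    have "emeasure lborel (A - N) = 0"
      using pos[of "A - N"] A em\<nu>[OF A(1)] Nb by (auto simp: zero_less_iff_neq_zero)
    then have "A - N \<in> null_sets lborel" using A(1) Nb by (simp add: null_sets_def)
    from null_sets.Un[OF this N] have "(A - N) \<union> N \<in> null_sets lborel" .
    then show ?thesis by (rule null_sets_subset) (use A(1) in \<open>simp, blast\<close>)
  qed
  show ?thesis
  proof (intro equalityI subsetI)
    fix B assume "B \<in> class_Int (essential_support ?\<nu>) G"
    then obtain A where A: "A \<in> sets borel" "emeasure ?\<nu> (UNIV - A) = 0" and B: "B = A \<inter> G"
      by (auto simp: class_Int_def essential_support_def)
    have "emeasure ?\<nu> (G - A) \<le> emeasure ?\<nu> (UNIV - A)"
      using A(1) by (intro emeasure_mono) auto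
    then have "G - A \<in> null_sets lborel" using A G by (intro lebesgue_null) auto
    moreover have "G - B = G - A" by (auto simp: B)
    ultimately show "B \<in> {B \<in> sets borel. B \<subseteq> G \<and> G - B \<in> null_sets lborel}"
      using A(1) G by (auto simp: B)
  next
    fix B assume "B \<in> {B \<in> sets borel. B \<subseteq> G \<and> G - B \<in> null_sets lborel}"
    then have B: "B \<in> sets borel" "B \<subseteq> G" "G - B \<in> null_sets lborel" by auto
    obtain A0 where "A0 \<in> essential_support ?\<nu>" using essential_support_exists[OF ac sets\<nu>] by blast
    then have A0: "A0 \<in> sets borel" "emeasure ?\<nu> (UNIV - A0) = 0"
      "absolutely_continuous ?\<nu> (density lborel (indicator A0))"
      by (auto simp: essential_support_def)
    define A where "A = B \<union> (A0 - G)"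
    have Ab: "A \<in> sets borel" using A0(1) B(1) G by (simp add: A_def)
    have "(UNIV - A0) \<union> (G - B) \<in> null_sets ?\<nu>"
      using A0(1,2) B(3) ac by (intro null_sets.Un) (auto simp: null_sets_def absolutely_continuous_def)
    then have "UNIV - A \<in> null_sets ?\<nu>"
      by (rule null_sets_subset) (use Ab in \<open>auto simp: A_def\<close>)
    then have 1: "emeasure ?\<nu> (UNIV - A) = 0" by (simp add: null_sets_def)
    have 2: "absolutely_continuous ?\<nu> (density lborel (indicator A))"
      unfolding absolutely_continuous_def
    proof
      fix C assume C: "C \<in> null_sets ?\<nu>"
      then have Cb: "C \<in> sets borel" by (auto simp: null_sets_def)
      have "C \<in> null_sets (density lborel (indicator A0))"
        using C A0(3) by (auto simp: absolutely_continuous_def)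
      then have "C \<inter> A0 \<in> null_sets lborel" using null_sets_density_indicator A0(1) Cb by blast
      moreover have "C \<inter> B \<in> null_sets lborel"
      proof (rule lebesgue_null)
        have "C \<inter> B \<in> null_sets ?\<nu>" using C by (rule null_sets_subset) (use Cb B in auto)
        then show "emeasure ?\<nu> (C \<inter> B) = 0" by (simp add: null_sets_def)
      qed (use Cb B in auto)
      ultimately have "(C \<inter> A0) \<union> (C \<inter> B) \<in> null_sets lborel" by (rule null_sets.Un)
      then have "C \<inter> A \<in> null_sets lborel"
        by (rule null_sets_subset) (use Cb Ab in \<open>auto simp: A_def\<close>)
      then show "C \<in> null_sets (density lborel (indicator A))"
        using null_sets_density_indicator Ab Cb by blast
    qed
    have "A \<in> essential_support ?\<nu>" using Ab 1 2 by (simp add: essential_support_def)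
    moreover have "B = A \<inter> G" using B(2) by (auto simp: A_def)
    ultimately show "B \<in> class_Int (essential_support ?\<nu>) G" by (auto simp: class_Int_def)
  qed
qed

section \<open>Energies with bounded transfer matrices\<close>

definition bounded_energies :: "(nat \<Rightarrow> real) \<Rightarrow> real \<Rightarrow> real set" where
  "bounded_energies b C = {E. \<forall>n\<ge>1. \<bar>recur b E 0 1 n\<bar> \<le> C \<and> \<bar>recur b E 1 0 n\<bar> \<le> C}"

lemma bounded_energies_mono: "C \<le> D \<Longrightarrow> bounded_energies b C \<subseteq> bounded_energies b D"
  unfolding bounded_energies_def by fastforce

lemma closed_bounded_energies: "closed (bounded_energies b C)"
proof -
  have "bounded_energies b C = (\<Inter>n\<in>{1..}. {E. \<bar>recur b E 0 1 n\<bar> \<le> C} \<inter> {E. \<bar>recur b E 1 0 n\<bar> \<le> C})"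
    by (auto simp: bounded_energies_def)
  moreover have "closed {E. \<bar>recur b E x y n\<bar> \<le> C}" for x y :: real and n
    by (intro closed_Collect_le continuous_intros)
  ultimately show ?thesis by (auto intro!: closed_INT closed_Int)
qed

lemma transfer_matrix_entries:
  "transfer_matrix b E n $ 1 $ 1 = recur b E 0 1 (Suc n)"
  "transfer_matrix b E n $ 1 $ 2 = recur b E 1 0 (Suc n)"
  "transfer_matrix b E n $ 2 $ 1 = recur b E 0 1 n"
  "transfer_matrix b E n $ 2 $ 2 = recur b E 1 0 n"
  by (induction n)
     (simp_all add: mat_def step_matrix_def matrix_matrix_mult_def sum_2)

lemma Gamma0_eq: "Gamma0 b = (\<Union>C::nat. bounded_energies b (real C))"
proof (intro equalityI subsetI)
  fix E assume "E \<in> Gamma0 b"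
  then obtain K where "\<forall>x\<in>transfer_norm b E ` {1..}. norm x \<le> K"
    by (auto simp: Gamma0_def bounded_iff)
  then have K: "transfer_norm b E n \<le> K" if "n \<ge> 1" for n using that by force
  obtain C :: nat where C: "K \<le> real C" using real_arch_simple by blast
  have "\<bar>transfer_matrix b E n $ 2 $ j\<bar> \<le> real C" if "n \<ge> 1" for n j
    using matrix_component_le_onorm[of "transfer_matrix b E n" 2 j] K[OF that] C
    unfolding transfer_norm_def by linarith
  from this[of _ 1] this[of _ 2] show "E \<in> (\<Union>C::nat. bounded_energies b (real C))"
    unfolding transfer_matrix_entries bounded_energies_def by blast
next
  fix E assume "E \<in> (\<Union>C::nat. bounded_energies b (real C))"
  then obtain C :: nat where C: "\<And>n. n \<ge> 1 \<Longrightarrow> \<bar>recur b E 0 1 n\<bar> \<le> real C \<and> \<bar>recur b E 1 0 n\<bar> \<le> real C"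
    by (auto simp: bounded_energies_def)
  have "norm (transfer_norm b E n) \<le> 4 * real C" if "n \<ge> 1" for n
  proof -
    have "\<bar>transfer_matrix b E n $ i $ j\<bar> \<le> real C" for i j
      using C[of n] C[of "Suc n"] that
      by (cases i rule: exhaust_2[THEN disjE]; cases j rule: exhaust_2[THEN disjE])
         (auto simp: transfer_matrix_entries)
    then have "transfer_norm b E n \<le> 4 * real C"
      unfolding transfer_norm_def using onorm_le_matrix_component[of "transfer_matrix b E n" "real C"] by simp
    moreover have "transfer_norm b E n \<ge> 0"
      unfolding transfer_norm_def by (rule onorm_pos_le[OF matrix_vector_mul_bounded_linear])
    ultimately show ?thesis by simp
  qed
  then show "E \<in> Gamma0 b" by (auto simp: Gamma0_def bounded_iff)
qed

lemma Gamma0_measurable: "Gamma0 b \<in> sets borel"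
  unfolding Gamma0_eq by (intro sets.countable_UN) (auto intro: borel_closed closed_bounded_energies)

text \<open>
Bounded closed pieces that exhaust \<open>\<Gamma>\<^sub>0\<close>; boundedness makes their Lebesgue measure finite.
\<close>
definition bounded_window :: "(nat \<Rightarrow> real) \<Rightarrow> nat \<Rightarrow> real set" where
  "bounded_window b C = bounded_energies b (real C) \<inter> {- real C..real C}"

lemma bounded_window_measurable [measurable]: "bounded_window b C \<in> sets borel"
  unfolding bounded_window_def using closed_bounded_energies by auto

lemma bounded_bounded_window: "bounded (bounded_window b C)"
  unfolding bounded_window_def by (rule bounded_subset[of "{- real C..real C}"]) auto

lemma emeasure_bounded_window: "emeasure lborel (bounded_window b C) \<le> ennreal (2 * real C)"
proof -
  have "emeasure lborel (bounded_window b C) \<le> emeasure lborel {- real C..real C}"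
    unfolding bounded_window_def by (intro emeasure_mono) auto
  then show ?thesis by simp
qed

lemma Gamma0_eq_windows: "Gamma0 b = (\<Union>C. bounded_window b C)"
proof (intro equalityI subsetI)
  fix E assume "E \<in> Gamma0 b"
  then obtain C :: nat where C: "E \<in> bounded_energies b (real C)" by (auto simp: Gamma0_eq)
  obtain D :: nat where D: "\<bar>E\<bar> \<le> real D" using real_arch_simple by blast
  have "E \<in> bounded_window b (max C D)"
    unfolding bounded_window_def using subsetD[OF bounded_energies_mono C, of "real (max C D)"] D by auto
  then show "E \<in> (\<Union>C. bounded_window b C)" by blast
qed (auto simp: Gamma0_eq bounded_window_def)

text \<open>
The potential \<open>b'\<close> may differ from the potential \<open>b\<close> that defines the set \<open>\<Gamma>\<^sub>0\<close>. It suffices to bound the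
integrals on each window separately, with a subsequence depending on the window: a subset of
\<open>\<Gamma>\<^sub>0\<close> of positive measure meets some window in positive measure.
\<close>
lemma class_Int_Sigma_ac:
  assumes "\<And>C. \<exists>L. \<exists>\<^sub>F n in sequentially.
    (\<integral>\<^sup>+E\<in>bounded_window b C. ennreal (dirichlet_sq b' (Suc n) E) \<partial>lborel) \<le> ennreal L"
  shows "class_Int (Sigma_ac (\<lambda>_. 1) b') (Gamma0 b)
    = {B \<in> sets borel. B \<subseteq> Gamma0 b \<and> Gamma0 b - B \<in> null_sets lborel}"
  unfolding Sigma_ac_def
proof (rule class_Int_ac_part)
  interpret real_distribution "spectral_measure (\<lambda>_. 1) b'" by (rule carmona_weak_convergence)
  show "finite_borel_measure (spectral_measure (\<lambda>_. 1) b')" by (rule finite_borel_measure_M)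
  fix A assume A: "A \<in> sets borel" "A \<subseteq> Gamma0 b" "emeasure lborel A > 0"
  have "\<exists>C. emeasure lborel (A \<inter> bounded_window b C) > 0"
  proof (rule ccontr)
    assume "\<not> ?thesis"
    then have "A \<inter> bounded_window b C \<in> null_sets lborel" for C
      using A(1) by (auto simp: null_sets_def zero_less_iff_neq_zero)
    then have "(\<Union>C. A \<inter> bounded_window b C) \<in> null_sets lborel" by (rule null_sets_UN)
    moreover have "(\<Union>C. A \<inter> bounded_window b C) = A" using A(2) by (auto simp: Gamma0_eq_windows)
    ultimately show False using A(3) by (simp add: null_sets_def)
  qed
  then obtain C where C: "emeasure lborel (A \<inter> bounded_window b C) > 0" by blast
  obtain L where "\<exists>\<^sub>F n in sequentially.
      (\<integral>\<^sup>+E\<in>bounded_window b C. ennreal (dirichlet_sq b' (Suc n) E) \<partial>lborel) \<le> ennreal L"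
    using assms by blast
  from spectral_measure_positive[OF bounded_bounded_window this _ _ C]
  have "emeasure (spectral_measure (\<lambda>_. 1) b') (A \<inter> bounded_window b C) > 0" using A(1) by auto
  also have "\<dots> \<le> emeasure (spectral_measure (\<lambda>_. 1) b') A"
    using A(1) by (intro emeasure_mono) auto
  finally show "emeasure (spectral_measure (\<lambda>_. 1) b') A > 0" .
qed (rule Gamma0_measurable)

lemma dirichlet_sq_bounded_energies:
  assumes "E \<in> bounded_energies b C" shows "dirichlet_sq b (Suc n) E \<le> 2 * C\<^sup>2"
proof -
  have "\<bar>recur b E 0 1 k\<bar> \<le> C" if "k \<ge> 1" for k using assms that by (auto simp: bounded_energies_def)
  then have "(recur b E 0 1 k)\<^sup>2 \<le> C\<^sup>2" if "k \<ge> 1" for k using that by (meson abs_le_square_iff abs_ge_self order_trans)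
  from this[of "Suc n"] this[of "Suc (Suc n)"] show ?thesis unfolding dirichlet_sq_def by simp
qed

lemma window_energy_bounded:
  assumes "\<And>E. E \<in> bounded_window b C \<Longrightarrow> h E \<le> ennreal K" "K \<ge> 0"
  shows "(\<integral>\<^sup>+E\<in>bounded_window b C. h E \<partial>lborel) \<le> ennreal (K * (2 * real C))"
proof -
  have "(\<integral>\<^sup>+E\<in>bounded_window b C. h E \<partial>lborel) \<le> (\<integral>\<^sup>+E. ennreal K * indicator (bounded_window b C) E \<partial>lborel)"
    using assms(1) by (intro nn_integral_mono) (auto simp: indicator_def)
  also have "\<dots> = ennreal K * emeasure lborel (bounded_window b C)"
    by (rule nn_integral_cmult_indicator) simp
  also have "\<dots> \<le> ennreal K * ennreal (2 * real C)"
    by (intro mult_left_mono emeasure_bounded_window) simp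
  finally show ?thesis using assms(2) by (simp add: ennreal_mult)
qed

lemma recur_cong:
  assumes "\<And>k. 1 \<le> k \<Longrightarrow> k < n \<Longrightarrow> b k = b' k"
  shows "recur b z x y n = recur b' z x y n"
  using assms by (induction n rule: induct_nat_012) auto

lemma recur_measurable_component:
  assumes "m \<le> Suc n"
  shows "(\<lambda>w. recur (\<lambda>k. b k + w k) (E::real) x y m) \<in> borel_measurable (PiM {1..n} (\<lambda>_. borel))"
  using assms
proof (induction m rule: induct_nat_012)
  case (ge2 m)
  have [measurable]: "(\<lambda>w. w (Suc m)) \<in> borel_measurable (PiM {1..n} (\<lambda>_. borel :: real measure))"
    using ge2.prems by (intro measurable_component_singleton) auto
  have [measurable]: "(\<lambda>w. recur (\<lambda>k. b k + w k) E x y m) \<in> borel_measurable (PiM {1..n} (\<lambda>_. borel))"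
    "(\<lambda>w. recur (\<lambda>k. b k + w k) E x y (Suc m)) \<in> borel_measurable (PiM {1..n} (\<lambda>_. borel))"
    using ge2 by auto
  show ?case unfolding recur.simps by measurable
qed auto

section \<open>Second moments of the perturbed solution\<close>

text \<open>
Variation of parameters: the coordinates of the Dirichlet solution for the potential \<open>b'\<close> with respect to
the two standard solutions for \<open>b\<close>, matched at the sites \<open>n\<close> and \<open>n + 1\<close>. By Cramer's rule they are
Wronskians of the solutions involved.
\<close>
definition coord1 :: "(nat \<Rightarrow> real) \<Rightarrow> (nat \<Rightarrow> real) \<Rightarrow> real \<Rightarrow> nat \<Rightarrow> real" where
  "coord1 b b' E n = recur b' E 0 1 (Suc n) * recur b E 1 0 n - recur b' E 0 1 n * recur b E 1 0 (Suc n)"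

definition coord2 :: "(nat \<Rightarrow> real) \<Rightarrow> (nat \<Rightarrow> real) \<Rightarrow> real \<Rightarrow> nat \<Rightarrow> real" where
  "coord2 b b' E n = recur b' E 0 1 n * recur b E 0 1 (Suc n) - recur b' E 0 1 (Suc n) * recur b E 0 1 n"

definition coord_sq :: "(nat \<Rightarrow> real) \<Rightarrow> (nat \<Rightarrow> real) \<Rightarrow> real \<Rightarrow> nat \<Rightarrow> real" where
  "coord_sq b b' E n = (coord1 b b' E n)\<^sup>2 + (coord2 b b' E n)\<^sup>2"

lemma coord_expansion:
  "recur b' E 0 1 n = coord1 b b' E n * recur b E 0 1 n + coord2 b b' E n * recur b E 1 0 n" (is ?A)
  "recur b' E 0 1 (Suc n) = coord1 b b' E n * recur b E 0 1 (Suc n) + coord2 b b' E n * recur b E 1 0 (Suc n)" (is ?B)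
proof -
  let ?w = "recur b E 0 1 (Suc n) * recur b E 1 0 n - recur b E 0 1 n * recur b E 1 0 (Suc n)"
  have "coord1 b b' E n * recur b E 0 1 n + coord2 b b' E n * recur b E 1 0 n = recur b' E 0 1 n * ?w"
    unfolding coord1_def coord2_def by algebra
  then show ?A unfolding wronskian by simp
  have "coord1 b b' E n * recur b E 0 1 (Suc n) + coord2 b b' E n * recur b E 1 0 (Suc n) = recur b' E 0 1 (Suc n) * ?w"
    unfolding coord1_def coord2_def by algebra
  then show ?B unfolding wronskian by simp
qed

lemma coord_step:
  "coord1 b b' E (Suc n) = coord1 b b' E n
     - (b' (Suc n) - b (Suc n)) * recur b' E 0 1 (Suc n) * recur b E 1 0 (Suc n)"
  "coord2 b b' E (Suc n) = coord2 b b' E n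
     + (b' (Suc n) - b (Suc n)) * recur b' E 0 1 (Suc n) * recur b E 0 1 (Suc n)"
  by (simp_all add: coord1_def coord2_def algebra_simps)

lemma linear_form_sq_bound:
  fixes p r C x y :: real
  assumes "\<bar>p\<bar> \<le> C" "\<bar>r\<bar> \<le> C"
  shows "(x * p + y * r)\<^sup>2 \<le> 2 * C\<^sup>2 * (x\<^sup>2 + y\<^sup>2)"
proof -
  have "p\<^sup>2 \<le> C\<^sup>2" "r\<^sup>2 \<le> C\<^sup>2" using assms by (meson abs_le_square_iff abs_ge_self order_trans)+
  then have "(x\<^sup>2 + y\<^sup>2) * (p\<^sup>2 + r\<^sup>2) \<le> (x\<^sup>2 + y\<^sup>2) * (2 * C\<^sup>2)" by (intro mult_left_mono) auto
  moreover have "(x * p + y * r)\<^sup>2 + (x * r - y * p)\<^sup>2 = (x\<^sup>2 + y\<^sup>2) * (p\<^sup>2 + r\<^sup>2)"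
    by (simp add: power2_eq_square algebra_simps)
  ultimately have "(x * p + y * r)\<^sup>2 \<le> (x\<^sup>2 + y\<^sup>2) * (2 * C\<^sup>2)"
    using zero_le_power2[of "x * r - y * p"] by linarith
  then show ?thesis by (simp only: mult.commute)
qed

lemma dirichlet_sq_le_coord_sq:
  assumes "E \<in> bounded_energies b C"
  shows "dirichlet_sq b' (Suc n) E \<le> 4 * C\<^sup>2 * coord_sq b b' E (Suc n)"
proof -
  have pr: "\<bar>recur b E 0 1 k\<bar> \<le> C" "\<bar>recur b E 1 0 k\<bar> \<le> C" if "k \<ge> 1" for k
    using assms that by (auto simp: bounded_energies_def)
  have "(recur b' E 0 1 (Suc n))\<^sup>2 \<le> 2 * C\<^sup>2 * coord_sq b b' E (Suc n)"
    unfolding coord_expansion(1)[of b' E "Suc n" b] coord_sq_def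
    by (rule linear_form_sq_bound; rule pr; simp)
  moreover have "(recur b' E 0 1 (Suc (Suc n)))\<^sup>2 \<le> 2 * C\<^sup>2 * coord_sq b b' E (Suc n)"
    unfolding coord_expansion(2)[of b' E "Suc n" b] coord_sq_def
    by (rule linear_form_sq_bound; rule pr; simp)
  ultimately show ?thesis unfolding dirichlet_sq_def by simp
qed

lemma coord_cong:
  assumes "\<And>k. 1 \<le> k \<Longrightarrow> k \<le> n \<Longrightarrow> b' k = b'' k"
  shows "coord1 b b' E n = coord1 b b'' E n" "coord2 b b' E n = coord2 b b'' E n"
proof -
  have "recur b' E 0 1 m = recur b'' E 0 1 m" if "m \<le> Suc n" for m
    using assms that by (intro recur_cong) auto
  then show "coord1 b b' E n = coord1 b b'' E n" "coord2 b b' E n = coord2 b b'' E n"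
    unfolding coord1_def coord2_def by (simp_all del: recur.simps)
qed

lemma coord_measurable [measurable]:
  "(\<lambda>w. coord1 b (\<lambda>k. b k + w k) E n) \<in> borel_measurable (PiM {1..n} (\<lambda>_. borel))"
  "(\<lambda>w. coord2 b (\<lambda>k. b k + w k) E n) \<in> borel_measurable (PiM {1..n} (\<lambda>_. borel))"
proof -
  note [measurable] = recur_measurable_component[of n n b E 0 1, OF le_SucI[OF order_refl]]
    recur_measurable_component[of "Suc n" n b E 0 1, OF order_refl]
  show "(\<lambda>w. coord1 b (\<lambda>k. b k + w k) E n) \<in> borel_measurable (PiM {1..n} (\<lambda>_. borel))"
    "(\<lambda>w. coord2 b (\<lambda>k. b k + w k) E n) \<in> borel_measurable (PiM {1..n} (\<lambda>_. borel))"
    unfolding coord1_def coord2_def by measurable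
qed

text \<open>
The congruence premise says that \<open>f\<close> depends on the coordinates \<open>1..n\<close> only, while \<open>f\<close> itself is applied to
whole sequences.
\<close>
lemma (in prob_space) indep_past_next:
  fixes bt :: "nat \<Rightarrow> 'a \<Rightarrow> real"
  assumes ind: "indep_vars (\<lambda>_. borel) bt {1..}"
    and f: "f \<in> borel_measurable (PiM {1..n} (\<lambda>_. borel))" and g: "g \<in> borel_measurable borel"
    and cong: "\<And>w. f w = f (restrict w {1..n})"
  shows "indep_var borel (\<lambda>\<omega>. f (\<lambda>k. bt k \<omega>) :: real) borel (\<lambda>\<omega>. g (bt (Suc n) \<omega>) :: real)"
proof -
  have "indep_var (PiM {1..n} (\<lambda>_. borel)) (\<lambda>\<omega>. restrict (\<lambda>i. bt i \<omega>) {1..n})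
      (PiM {Suc n} (\<lambda>_. borel)) (\<lambda>\<omega>. restrict (\<lambda>i. bt i \<omega>) {Suc n})"
    by (rule indep_var_restrict[OF ind]) auto
  moreover have "(\<lambda>w. g (w (Suc n))) \<in> borel_measurable (PiM {Suc n} (\<lambda>_. borel))"
    by (rule measurable_compose[where f="\<lambda>w. w (Suc n)" and N=borel, OF _ g])
       (rule measurable_component_singleton, simp)
  ultimately have "indep_var borel (f \<circ> (\<lambda>\<omega>. restrict (\<lambda>i. bt i \<omega>) {1..n}))
      borel ((\<lambda>w. g (w (Suc n))) \<circ> (\<lambda>\<omega>. restrict (\<lambda>i. bt i \<omega>) {Suc n}))"
    by (intro indep_var_compose[OF _ f])
  moreover have "f \<circ> (\<lambda>\<omega>. restrict (\<lambda>i. bt i \<omega>) {1..n}) = (\<lambda>\<omega>. f (\<lambda>k. bt k \<omega>))"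
    unfolding comp_def using cong by metis
  moreover have "(\<lambda>w. g (w (Suc n))) \<circ> (\<lambda>\<omega>. restrict (\<lambda>i. bt i \<omega>) {Suc n}) = (\<lambda>\<omega>. g (bt (Suc n) \<omega>))"
    by (simp add: comp_def)
  ultimately show ?thesis by metis
qed

text \<open>
One step of the recurrence reads \<open>Q (n+1) = Q n + X * \<beta> + Y * \<beta>\<^sup>2\<close> with \<open>\<beta> = bt (n+1)\<close>, where \<open>X\<close> and \<open>Y\<close> depend on
\<open>bt 1, \<dots>, bt n\<close> and are bounded by multiples of \<open>Q n\<close>. The linear term has expectation zero, and the quadratic
one at most \<open>4 C^4\<close> times the variance of \<open>\<beta>\<close> times the expectation of \<open>Q n\<close>.
\<close>
lemma (in prob_space) coord_sq_second_moment:
  fixes bt :: "nat \<Rightarrow> 'a \<Rightarrow> real"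
  assumes ind: "indep_vars (\<lambda>_. borel) bt {1..}"
    and sq: "\<And>n. n \<ge> 1 \<Longrightarrow> integrable M (\<lambda>\<omega>. (bt n \<omega>)\<^sup>2)"
    and mean: "\<And>n. n \<ge> 1 \<Longrightarrow> expectation (bt n) = 0"
    and E: "E \<in> bounded_energies b C"
  defines "Q \<equiv> \<lambda>n \<omega>. coord_sq b (\<lambda>k. b k + bt k \<omega>) E n"
  shows "integrable M (Q n) \<and>
    expectation (Q n) \<le> exp (4 * C^4 * (\<Sum>k=1..n. expectation (\<lambda>\<omega>. (bt k \<omega>)\<^sup>2)))"
proof (induction n)
  case 0
  then show ?case by (simp add: Q_def coord_sq_def coord1_def coord2_def prob_space)
next
  case (Suc n)
  let ?p = "recur b E 0 1 (Suc n)" and ?r = "recur b E 1 0 (Suc n)"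
  have pr: "\<bar>?p\<bar> \<le> C" "\<bar>?r\<bar> \<le> C" using E by (auto simp: bounded_energies_def simp del: recur.simps)
  define c1 where "c1 w = coord1 b (\<lambda>k. b k + w k) E n" for w
  define c2 where "c2 w = coord2 b (\<lambda>k. b k + w k) E n" for w
  define P where "P w = c1 w * ?p + c2 w * ?r" for w
  define Z where "Z w = c2 w * ?p + (- c1 w) * ?r" for w
  define X where "X w = 2 * P w * Z w" for w
  define Y where "Y w = (P w)\<^sup>2 * (?p\<^sup>2 + ?r\<^sup>2)" for w
  define s where "s = expectation (\<lambda>\<omega>. (bt (Suc n) \<omega>)\<^sup>2)"
  have [measurable]: "random_variable borel (bt k)" if "k \<ge> 1" for k
    using ind that by (auto simp: indep_vars_def)
  have cong: "c1 w = c1 (restrict w {1..n})" "c2 w = c2 (restrict w {1..n})" for w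
    unfolding c1_def c2_def by (intro coord_cong; simp)+
  have cong': "X w = X (restrict w {1..n})" "Y w = Y (restrict w {1..n})" for w
    unfolding X_def Y_def P_def Z_def using cong[of w] by simp_all
  have c_meas [measurable]: "c1 \<in> borel_measurable (PiM {1..n} (\<lambda>_. borel))"
    "c2 \<in> borel_measurable (PiM {1..n} (\<lambda>_. borel))"
    using coord_measurable[of b E n] unfolding c1_def c2_def by auto
  have XY_meas: "X \<in> borel_measurable (PiM {1..n} (\<lambda>_. borel))" "Y \<in> borel_measurable (PiM {1..n} (\<lambda>_. borel))"
    unfolding X_def Y_def P_def Z_def by measurable
  have iX: "indep_var borel (\<lambda>\<omega>. X (\<lambda>k. bt k \<omega>)) borel (\<lambda>\<omega>. bt (Suc n) \<omega>)"
    by (rule indep_past_next[OF ind XY_meas(1) _ cong'(1), where g="\<lambda>x. x"]) simp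
  have iY: "indep_var borel (\<lambda>\<omega>. Y (\<lambda>k. bt k \<omega>)) borel (\<lambda>\<omega>. (bt (Suc n) \<omega>)\<^sup>2)"
    by (rule indep_past_next[OF ind XY_meas(2) _ cong'(2), where g="\<lambda>x. x\<^sup>2"]) simp
  have Qc: "Q n \<omega> = (c1 (\<lambda>k. bt k \<omega>))\<^sup>2 + (c2 (\<lambda>k. bt k \<omega>))\<^sup>2" for \<omega>
    by (simp add: Q_def coord_sq_def c1_def c2_def)
  have Pb: "(P (\<lambda>k. bt k \<omega>))\<^sup>2 \<le> 2 * C\<^sup>2 * Q n \<omega>" for \<omega>
    unfolding P_def Qc by (rule linear_form_sq_bound[OF pr])
  have Zb: "(Z (\<lambda>k. bt k \<omega>))\<^sup>2 \<le> 2 * C\<^sup>2 * Q n \<omega>" for \<omega>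
    using linear_form_sq_bound[OF pr, of "c2 (\<lambda>k. bt k \<omega>)" "- c1 (\<lambda>k. bt k \<omega>)"]
    unfolding Z_def Qc by (simp add: add.commute)
  have Q0: "Q n \<omega> \<ge> 0" for \<omega> unfolding Qc by simp
  have Xb: "\<bar>X (\<lambda>k. bt k \<omega>)\<bar> \<le> 4 * C\<^sup>2 * Q n \<omega>" for \<omega>
  proof -
    have "\<bar>2 * x * z\<bar> \<le> x\<^sup>2 + z\<^sup>2" for x z :: real
      using sum_squares_bound[of "\<bar>x\<bar>" "\<bar>z\<bar>"] by (simp add: abs_mult)
    from this[of "P (\<lambda>k. bt k \<omega>)" "Z (\<lambda>k. bt k \<omega>)"]
    show ?thesis unfolding X_def using Pb[of \<omega>] Zb[of \<omega>] by linarith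
  qed
  have Yb: "Y (\<lambda>k. bt k \<omega>) \<le> 4 * C^4 * Q n \<omega>" for \<omega>
  proof -
    have "?p\<^sup>2 \<le> C\<^sup>2" "?r\<^sup>2 \<le> C\<^sup>2" using pr by (meson abs_le_square_iff abs_ge_self order_trans)+
    then have "Y (\<lambda>k. bt k \<omega>) \<le> (2 * C\<^sup>2 * Q n \<omega>) * (2 * C\<^sup>2)"
      unfolding Y_def using Pb[of \<omega>] Q0[of \<omega>] by (intro mult_mono) auto
    then show ?thesis by (simp add: power4_eq_xxxx power2_eq_square mult.commute mult.left_commute)
  qed
  have Y0: "Y w \<ge> 0" for w by (simp add: Y_def)
  have IQ: "integrable M (Q n)" using Suc.IH by simp
  have IX: "integrable M (\<lambda>\<omega>. X (\<lambda>k. bt k \<omega>))"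
    by (rule Bochner_Integration.integrable_bound[OF integrable_mult_right[OF IQ, of "4 * C\<^sup>2"]])
       (use indep_var_rv1[OF iX] Xb Q0 in \<open>auto simp: abs_mult\<close>)
  have IY: "integrable M (\<lambda>\<omega>. Y (\<lambda>k. bt k \<omega>))"
    by (rule Bochner_Integration.integrable_bound[OF integrable_mult_right[OF IQ, of "4 * C^4"]])
       (use indep_var_rv1[OF iY] Yb Y0 Q0 in \<open>auto simp: abs_mult\<close>)
  have Ib: "integrable M (bt (Suc n))"
    using square_integrable_imp_integrable[of "bt (Suc n)"] sq[of "Suc n"] by auto
  have Is: "integrable M (\<lambda>\<omega>. (bt (Suc n) \<omega>)\<^sup>2)" by (rule sq) simp
  have step: "Q (Suc n) \<omega> = Q n \<omega> + X (\<lambda>k. bt k \<omega>) * bt (Suc n) \<omega> + Y (\<lambda>k. bt k \<omega>) * (bt (Suc n) \<omega>)\<^sup>2" for \<omega>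
  proof -
    let ?b = "\<lambda>k. b k + bt k \<omega>"
    have P: "recur ?b E 0 1 (Suc n) = P (\<lambda>k. bt k \<omega>)"
      using coord_expansion(2)[of ?b E n b] by (simp add: P_def c1_def c2_def del: recur.simps)
    have 1: "coord1 b ?b E (Suc n) = c1 (\<lambda>k. bt k \<omega>) - bt (Suc n) \<omega> * P (\<lambda>k. bt k \<omega>) * ?r"
      unfolding coord_step P by (simp add: c1_def)
    have 2: "coord2 b ?b E (Suc n) = c2 (\<lambda>k. bt k \<omega>) + bt (Suc n) \<omega> * P (\<lambda>k. bt k \<omega>) * ?p"
      unfolding coord_step P by (simp add: c2_def)
    show ?thesis
      unfolding Qc unfolding Q_def coord_sq_def 1 2 X_def Y_def Z_def power2_eq_square
      by (simp only: algebra_simps)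
  qed
  have I1: "integrable M (\<lambda>\<omega>. X (\<lambda>k. bt k \<omega>) * bt (Suc n) \<omega>)"
    by (rule indep_var_integrable[OF iX IX Ib])
  have I2: "integrable M (\<lambda>\<omega>. Y (\<lambda>k. bt k \<omega>) * (bt (Suc n) \<omega>)\<^sup>2)"
    by (rule indep_var_integrable[OF iY IY Is])
  have int: "integrable M (Q (Suc n))"
    unfolding step by (intro Bochner_Integration.integrable_add IQ I1 I2)
  have s0: "s \<ge> 0" unfolding s_def by simp
  have "expectation (Q (Suc n)) = expectation (Q n) + expectation (\<lambda>\<omega>. X (\<lambda>k. bt k \<omega>) * bt (Suc n) \<omega>)
      + expectation (\<lambda>\<omega>. Y (\<lambda>k. bt k \<omega>) * (bt (Suc n) \<omega>)\<^sup>2)"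
    unfolding step
    by (subst Bochner_Integration.integral_add[OF Bochner_Integration.integrable_add[OF IQ I1] I2],
        subst Bochner_Integration.integral_add[OF IQ I1]) simp
  also have "expectation (\<lambda>\<omega>. X (\<lambda>k. bt k \<omega>) * bt (Suc n) \<omega>) = 0"
    by (subst indep_var_lebesgue_integral[OF iX IX Ib]) (simp add: mean)
  also have "expectation (\<lambda>\<omega>. Y (\<lambda>k. bt k \<omega>) * (bt (Suc n) \<omega>)\<^sup>2) = expectation (\<lambda>\<omega>. Y (\<lambda>k. bt k \<omega>)) * s"
    unfolding s_def by (rule indep_var_lebesgue_integral[OF iY IY Is])
  also have "expectation (\<lambda>\<omega>. Y (\<lambda>k. bt k \<omega>)) \<le> expectation (\<lambda>\<omega>. 4 * C^4 * Q n \<omega>)"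
    by (intro integral_mono IY integrable_mult_right IQ Yb)
  also have "expectation (\<lambda>\<omega>. 4 * C^4 * Q n \<omega>) = 4 * C^4 * expectation (Q n)" by simp
  finally have "expectation (Q (Suc n)) \<le> (1 + 4 * C^4 * s) * expectation (Q n)"
    using s0 by (simp add: algebra_simps mult_right_mono)
  also have "\<dots> \<le> exp (4 * C^4 * s) * exp (4 * C^4 * (\<Sum>k=1..n. expectation (\<lambda>\<omega>. (bt k \<omega>)\<^sup>2)))"
    using Suc.IH s0 Q0 exp_ge_add_one_self[of "4 * C^4 * s"]
    by (intro mult_mono) (auto intro!: integral_nonneg_AE)
  also have "\<dots> = exp (4 * C^4 * (\<Sum>k=1..Suc n. expectation (\<lambda>\<omega>. (bt k \<omega>)\<^sup>2)))"
    by (simp add: s_def exp_add[symmetric] algebra_simps)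
  finally show ?case using int by simp
qed

section \<open>Perturbed and unperturbed essential supports\<close>

text \<open>
By Fatou's lemma the lower limit is integrable, hence finite almost everywhere; the bound \<open>L\<close> and the indices
depend on the point.
\<close>
lemma AE_frequently_bounded:
  fixes f :: "nat \<Rightarrow> 'a \<Rightarrow> ennreal"
  assumes f [measurable]: "\<And>n. f n \<in> borel_measurable M" and bd: "\<And>n. (\<integral>\<^sup>+x. f n x \<partial>M) \<le> ennreal K"
  shows "AE x in M. \<exists>L. \<exists>\<^sub>F n in sequentially. f n x \<le> ennreal L"
proof -
  have "(\<integral>\<^sup>+x. liminf (\<lambda>n. f n x) \<partial>M) \<le> liminf (\<lambda>n. \<integral>\<^sup>+x. f n x \<partial>M)"
    by (rule nn_integral_liminf) simp
  also have "\<dots> \<le> liminf (\<lambda>n. ennreal K)" by (intro Liminf_mono always_eventually allI bd)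
  also have "\<dots> = ennreal K" by (rule Liminf_const) simp
  finally have "(\<integral>\<^sup>+x. liminf (\<lambda>n. f n x) \<partial>M) \<noteq> \<infinity>" by (auto simp: top_unique)
  then have "AE x in M. liminf (\<lambda>n. f n x) \<noteq> \<infinity>" by (intro nn_integral_PInf_AE) auto
  then show ?thesis
  proof eventually_elim
    case (elim x)
    then obtain l where l: "l \<ge> 0" "liminf (\<lambda>n. f n x) = ennreal l"
      by (cases "liminf (\<lambda>n. f n x)") auto
    have "\<exists>\<^sub>F n in sequentially. f n x \<le> ennreal (l + 1)"
    proof (rule ccontr)
      assume "\<not> ?thesis"
      then have "\<forall>\<^sub>F n in sequentially. ennreal (l + 1) \<le> f n x"
        unfolding not_frequently by eventually_elim simp
      from Liminf_bounded[OF this] show False using l by simp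
    qed
    then show ?case by blast
  qed
qed

lemma recur_pair_measurable:
  fixes bt :: "nat \<Rightarrow> 'w \<Rightarrow> real"
  assumes [measurable]: "\<And>k. bt (Suc k) \<in> borel_measurable M"
  shows "(\<lambda>(\<omega>, E). recur (\<lambda>k. b k + bt k \<omega>) E x y n) \<in> borel_measurable (M \<Otimes>\<^sub>M lborel)"
proof (induction n rule: induct_nat_012)
  case (ge2 n)
  note [measurable] = ge2[unfolded split_beta]
  show ?case unfolding recur.simps split_beta of_real_eq_id id_apply by measurable
qed auto

theorem corollary1p2:
  fixes M :: "'w measure"
    and b :: "nat \<Rightarrow> real"
    and bt :: "nat \<Rightarrow> 'w \<Rightarrow> real"
  assumes "prob_space M"
    and "prob_space.indep_vars M (\<lambda>_. borel) bt {1..}"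
    and "\<And>n. n \<ge> 1 \<Longrightarrow> integrable M (\<lambda>\<omega>. (bt n \<omega>)\<^sup>2)"
    and "\<And>n. n \<ge> 1 \<Longrightarrow> (\<integral>\<omega>. bt n \<omega> \<partial>M) = 0"
    and "summable (\<lambda>n. \<integral>\<omega>. (bt (Suc n) \<omega>)\<^sup>2 \<partial>M)"
  shows "AE \<omega> in M.
    class_Int (Sigma_ac (\<lambda>_. 1) b) (Gamma0 b) =
    class_Int (Sigma_ac (\<lambda>_. 1) (\<lambda>n. b n + bt n \<omega>)) (Gamma0 b)"
proof -
  interpret prob_space M by fact
  have [measurable]: "bt (Suc k) \<in> borel_measurable M" for k
    using assms(2) by (auto simp: indep_vars_def)
  define V where "V = (\<Sum>n. \<integral>\<omega>. (bt (Suc n) \<omega>)\<^sup>2 \<partial>M)"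
  have V: "(\<Sum>k=1..n. \<integral>\<omega>. (bt k \<omega>)\<^sup>2 \<partial>M) \<le> V" for n
  proof -
    have "(\<Sum>k=1..n. \<integral>\<omega>. (bt k \<omega>)\<^sup>2 \<partial>M) = (\<Sum>k<n. \<integral>\<omega>. (bt (Suc k) \<omega>)\<^sup>2 \<partial>M)"
      by (rule sum.reindex_bij_witness[of _ Suc "\<lambda>k. k - 1"]) auto
    also have "\<dots> \<le> V" unfolding V_def by (rule sum_le_suminf[OF assms(5)]) auto
    finally show ?thesis .
  qed
  let ?g = "\<lambda>n \<omega> E. ennreal (dirichlet_sq (\<lambda>k. b k + bt k \<omega>) (Suc n) E)"
  have g_meas: "(\<lambda>(\<omega>, E). ?g n \<omega> E) \<in> borel_measurable (M \<Otimes>\<^sub>M lborel)" for n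
  proof -
    note [measurable] = recur_pair_measurable[of bt M b, unfolded split_beta]
    show ?thesis unfolding dirichlet_sq_def split_beta by measurable
  qed
  have moment: "(\<integral>\<^sup>+\<omega>. ?g n \<omega> E \<partial>M) \<le> ennreal (4 * (real C)\<^sup>2 * exp (4 * (real C)^4 * V))"
    if E: "E \<in> bounded_window b C" for n E C
  proof -
    have E': "E \<in> bounded_energies b (real C)" using E by (simp add: bounded_window_def)
    let ?Q = "\<lambda>\<omega>. coord_sq b (\<lambda>k. b k + bt k \<omega>) E (Suc n)"
    note Q = coord_sq_second_moment[OF assms(2-4) E', of "Suc n"]
    have "(\<integral>\<^sup>+\<omega>. ?g n \<omega> E \<partial>M) \<le> (\<integral>\<^sup>+\<omega>. ennreal (4 * (real C)\<^sup>2 * ?Q \<omega>) \<partial>M)"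
      by (intro nn_integral_mono ennreal_leI dirichlet_sq_le_coord_sq E')
    also have "\<dots> = ennreal (\<integral>\<omega>. 4 * (real C)\<^sup>2 * ?Q \<omega> \<partial>M)"
      using Q by (intro nn_integral_eq_integral) (auto simp: coord_sq_def)
    also have "(\<integral>\<omega>. 4 * (real C)\<^sup>2 * ?Q \<omega> \<partial>M) = 4 * (real C)\<^sup>2 * (\<integral>\<omega>. ?Q \<omega> \<partial>M)" by simp
    also have "(\<integral>\<omega>. ?Q \<omega> \<partial>M) \<le> exp (4 * (real C)^4 * (\<Sum>k=1..Suc n. \<integral>\<omega>. (bt k \<omega>)\<^sup>2 \<partial>M))"
      using Q by blast
    also have "\<dots> \<le> exp (4 * (real C)^4 * V)"
      using V[of "Suc n"] by (intro exp_le_cancel_iff[THEN iffD2] mult_left_mono) auto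
    finally show ?thesis by (simp add: ennreal_leI mult_left_mono)
  qed
  have ae: "AE \<omega> in M. \<exists>L. \<exists>\<^sub>F n in sequentially. (\<integral>\<^sup>+E\<in>bounded_window b C. ?g n \<omega> E \<partial>lborel) \<le> ennreal L" for C
  proof (rule AE_frequently_bounded)
    interpret P: pair_sigma_finite M lborel ..
    have joint: "(\<lambda>(\<omega>, E). ?g n \<omega> E * indicator (bounded_window b C) E) \<in> borel_measurable (M \<Otimes>\<^sub>M lborel)" for n
      using g_meas[of n] unfolding split_beta by measurable
    show "(\<lambda>\<omega>. \<integral>\<^sup>+E\<in>bounded_window b C. ?g n \<omega> E \<partial>lborel) \<in> borel_measurable M" for n
      using lborel.borel_measurable_nn_integral[OF joint[of n]] .
    show "(\<integral>\<^sup>+\<omega>. (\<integral>\<^sup>+E\<in>bounded_window b C. ?g n \<omega> E \<partial>lborel) \<partial>M)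
        \<le> ennreal (4 * (real C)\<^sup>2 * exp (4 * (real C)^4 * V) * (2 * real C))" for n
    proof -
      have "(\<integral>\<^sup>+\<omega>. (\<integral>\<^sup>+E\<in>bounded_window b C. ?g n \<omega> E \<partial>lborel) \<partial>M)
          = (\<integral>\<^sup>+E. (\<integral>\<^sup>+\<omega>. ?g n \<omega> E * indicator (bounded_window b C) E \<partial>M) \<partial>lborel)"
        using P.Fubini'[OF joint[of n]] by simp
      also have "\<dots> = (\<integral>\<^sup>+E\<in>bounded_window b C. (\<integral>\<^sup>+\<omega>. ?g n \<omega> E \<partial>M) \<partial>lborel)"
        by (intro nn_integral_cong) (auto simp: indicator_def)
      also have "\<dots> \<le> ennreal (4 * (real C)\<^sup>2 * exp (4 * (real C)^4 * V) * (2 * real C))"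
        by (rule window_energy_bounded[OF moment]) auto
      finally show ?thesis .
    qed
  qed
  have unperturbed: "class_Int (Sigma_ac (\<lambda>_. 1) b) (Gamma0 b)
      = {B \<in> sets borel. B \<subseteq> Gamma0 b \<and> Gamma0 b - B \<in> null_sets lborel}"
  proof (rule class_Int_Sigma_ac)
    fix C
    have "(\<integral>\<^sup>+E\<in>bounded_window b C. ennreal (dirichlet_sq b (Suc n) E) \<partial>lborel)
        \<le> ennreal (2 * (real C)\<^sup>2 * (2 * real C))" for n
      by (rule window_energy_bounded)
         (auto simp: bounded_window_def intro!: ennreal_leI dirichlet_sq_bounded_energies)
    then show "\<exists>L. \<exists>\<^sub>F n in sequentially.
        (\<integral>\<^sup>+E\<in>bounded_window b C. ennreal (dirichlet_sq b (Suc n) E) \<partial>lborel) \<le> ennreal L"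
      by (intro exI eventually_frequently always_eventually allI) auto
  qed
  have "AE \<omega> in M. \<forall>C. \<exists>L. \<exists>\<^sub>F n in sequentially.
      (\<integral>\<^sup>+E\<in>bounded_window b C. ?g n \<omega> E \<partial>lborel) \<le> ennreal L"
    using ae by (simp add: AE_all_countable)
  then show ?thesis
  proof eventually_elim
    case (elim \<omega>)
    then show ?case unfolding unperturbed by (subst class_Int_Sigma_ac) auto
  qed
qed

end
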